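(* Let $k\ge 1$ and let $a_1,\ldots,a_k\ge 1$ be integers with $\sum_{i=1}^k a_i=r$. Let $$A_{a_1,\ldots,a_k}(y)=\sum_{i=0}^{r-k}A_{0^i,a_1,\ldots,a_k,0^{r-k-i}}\,y^i$$ be the mixed Eulerian polynomial. Then, as formal power series in $y$, $$A_{a_1,\ldots,a_k}(y)=(1-y)^{r+1}\sum_{i=0}^{\infty}(i+1)^{a_1}(i+2)^{a_2}\cdots(i+k)^{a_k}\,y^i.$$
   Context: Mixed Eulerian numbers: for integers $m\ge 1$ and $1\le j\le m$, let $P_{j,m+1}=[0,1]^{m+1}\cap\{\sum x_i=j\}\subset\mathbb{R}^{m+1}$ (hypersimplex). For nonnegative integers $b_1,\ldots,b_m$ with $\sum b_j=m$, $A_{b_1,\ldots,b_m}$ is $m!$ times the mixed volume of the $m$ polytopes consisting of $b_j$ copies of $P_{j,m+1}$ for each $j$ (each translated by an integer vector into the hyperplane $\{\sum x_i=0\}$), where volume is normalized so that the lattice $\{\sum x_i=0\}\cap\mathbb{Z}^{m+1}$ has covolume $1$ and the mixed volume satisfies $\operatorname{MV}(P,\ldots,P)=\operatorname{vol}(P)$. The symbol $0^i$ denotes $i$ consecutive zeros. *)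

theory Defs
  imports "HOL-Analysis.Analysis" "HOL-Computational_Algebra.Polynomial_FPS"
begin

text \<open>
  Points of the Euclidean space of dimension \<open>n\<close> are functions in \<open>{..<n} \<rightarrow>\<^sub>E UNIV\<close>, so that
  coordinates are numbered from \<open>0\<close> and \<open>n\<close> may vary inside a formula.
\<close>

definition hypersimplex :: "nat \<Rightarrow> nat \<Rightarrow> (nat \<Rightarrow> real) set" where
  "hypersimplex j n = {x \<in> {..<n} \<rightarrow>\<^sub>E {0..1}. (\<Sum>i<n. x i) = real j}"

text \<open>
  The hypersimplex in dimension \<open>m + 1\<close>, translated into the hyperplane of coordinate sum \<open>0\<close> by
  the integer vector whose only nonzero entry is the last one, \<open>- j\<close>. Mixed volumes are invariant
  under translations inside the hyperplane, so any other integer vector of sum \<open>- j\<close> would do.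
\<close>

definition hypersimplex0 :: "nat \<Rightarrow> nat \<Rightarrow> (nat \<Rightarrow> real) set" where
  "hypersimplex0 m j =
     (\<lambda>x. \<lambda>i\<in>{..<Suc m}. x i - (if i = m then real j else 0)) ` hypersimplex j (Suc m)"

text \<open>
  Lattice-normalised volume of a subset of the hyperplane of coordinate sum \<open>0\<close> in dimension
  \<open>m + 1\<close>. Forgetting the last coordinate is a linear isomorphism of this hyperplane onto the
  space of dimension \<open>m\<close> which maps the integer points of the hyperplane bijectively onto all
  integer points; hence the pullback of Lebesgue measure gives that lattice covolume \<open>1\<close>.
\<close>

definition lattice_volume :: "nat \<Rightarrow> (nat \<Rightarrow> real) set \<Rightarrow> real" where
  "lattice_volume m X =
     measure (Pi\<^sub>M {..<m} (\<lambda>_. lborel)) ((\<lambda>x. restrict x {..<m}) ` X)"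

text \<open>The Minkowski combination of \<open>K 0, \<dots>, K (m - 1)\<close>, with coefficients \<open>l 0, \<dots>, l (m - 1)\<close>.\<close>

definition minkowski_comb ::
    "nat \<Rightarrow> (nat \<Rightarrow> real) \<Rightarrow> (nat \<Rightarrow> (nat \<Rightarrow> real) set) \<Rightarrow> (nat \<Rightarrow> real) set" where
  "minkowski_comb m l K =
     {(\<lambda>i\<in>{..<Suc m}. \<Sum>t<m. l t * x t i) | x. \<forall>t<m. x t \<in> K t}"

definition exponents :: "nat \<Rightarrow> (nat \<Rightarrow> nat) set" where
  "exponents m = {\<alpha> \<in> {..<m} \<rightarrow>\<^sub>E UNIV. (\<Sum>t<m. \<alpha> t) = m}"

definition volume_polynomial ::
    "nat \<Rightarrow> (nat \<Rightarrow> (nat \<Rightarrow> real) set) \<Rightarrow> ((nat \<Rightarrow> nat) \<Rightarrow> real) \<Rightarrow> bool" where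
  "volume_polynomial m K c \<longleftrightarrow>
     (\<forall>l. (\<forall>t<m. 0 \<le> l t) \<longrightarrow>
        lattice_volume m (minkowski_comb m l K) = (\<Sum>\<alpha>\<in>exponents m. c \<alpha> * (\<Prod>t<m. l t ^ \<alpha> t)))"

text \<open>
  Minkowski's definition: for convex bodies \<open>K 0, \<dots>, K (m - 1)\<close> the volume of a Minkowski
  combination is a homogeneous polynomial of degree \<open>m\<close> in the (nonnegative) coefficients, and
  \<open>m!\<close> times the mixed volume is the coefficient of the squarefree monomial \<open>l 0 \<cdots> l (m - 1)\<close>.
  If all bodies are equal to \<open>P\<close>, the polynomial is \<open>(l 0 + \<cdots> + l (m - 1)) ^ m\<close> times the volume
  of \<open>P\<close>, so the factor \<open>1 / m!\<close> is the normalisation in which the mixed volume of copies of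
  \<open>P\<close> is the volume of \<open>P\<close>. The polynomial determines the coefficient, see \<open>mixed_volume_eq\<close>.
\<close>

definition mixed_volume :: "nat \<Rightarrow> (nat \<Rightarrow> (nat \<Rightarrow> real) set) \<Rightarrow> real" where
  "mixed_volume m K =
     (THE v. \<exists>c. volume_polynomial m K c \<and> v = c (\<lambda>t\<in>{..<m}. 1) / fact m)"

lemma finite_exponents: "finite (exponents m)"
proof (rule finite_subset)
  show "exponents m \<subseteq> {..<m} \<rightarrow>\<^sub>E {..m}"
  proof
    fix \<alpha> assume a: "\<alpha> \<in> exponents m"
    have "\<alpha> t \<le> m" if "t < m" for t
      using a that member_le_sum[of t "{..<m}" \<alpha>] by (auto simp: exponents_def)
    with a show "\<alpha> \<in> {..<m} \<rightarrow>\<^sub>E {..m}" by (auto simp: exponents_def PiE_def)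
  qed
qed (simp add: finite_PiE)

lemma exponents_positive_imp_one:
  assumes "\<alpha> \<in> exponents m" and "\<And>t. t < m \<Longrightarrow> \<alpha> t \<noteq> 0"
  shows "\<alpha> = (\<lambda>t\<in>{..<m}. 1)"
proof -
  have "(\<Sum>t<m. \<alpha> t - 1) + (\<Sum>t<m. 1) = (\<Sum>t<m. \<alpha> t)"
    unfolding sum.distrib[symmetric] by (rule sum.cong) (use assms(2) in force)+
  then have "(\<Sum>t<m. \<alpha> t - 1) = 0"
    using assms(1) by (simp add: exponents_def)
  then have "\<alpha> t = 1" if "t < m" for t
    using that assms(2)[of t] by (auto simp: le_antisym)
  then show ?thesis
    using assms(1) by (auto simp: exponents_def PiE_def extensional_def fun_eq_iff)
qed

text \<open>Evaluating at all 0-1-vectors with signs isolates the squarefree coefficient.\<close>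

lemma squarefree_coefficient:
  fixes c :: "(nat \<Rightarrow> nat) \<Rightarrow> real"
  shows "(\<Sum>S\<in>Pow {..<m}. (- 1) ^ card ({..<m} - S) *
            (\<Sum>\<alpha>\<in>exponents m. c \<alpha> * (\<Prod>t<m. of_bool (t \<in> S) ^ \<alpha> t))) =
         c (\<lambda>t\<in>{..<m}. 1)"
proof -
  let ?one = "(\<lambda>t\<in>{..<m}. 1) :: nat \<Rightarrow> nat"
  have signed: "(\<Sum>S\<in>Pow {..<m}. (- 1) ^ card ({..<m} - S) * (\<Prod>t<m. of_bool (t \<in> S) ^ \<alpha> t)) =
          (\<Prod>t<m. 1 + (- ((0 :: real) ^ \<alpha> t)))" for \<alpha> :: "nat \<Rightarrow> nat"
  proof -
    have "(- 1) ^ card ({..<m} - S) * (\<Prod>t<m. of_bool (t \<in> S) ^ \<alpha> t) =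
          (\<Prod>t\<in>S. 1) * (\<Prod>t\<in>{..<m} - S. (- ((0 :: real) ^ \<alpha> t)))" if S: "S \<in> Pow {..<m}" for S
    proof -
      have "(\<Prod>t<m. of_bool (t \<in> S) ^ \<alpha> t) =
            (\<Prod>t\<in>{..<m} - S. of_bool (t \<in> S) ^ \<alpha> t) * (\<Prod>t\<in>S. (of_bool (t \<in> S) :: real) ^ \<alpha> t)"
        using S by (intro prod.subset_diff) auto
      also have "\<dots> = (\<Prod>t\<in>{..<m} - S. (0 :: real) ^ \<alpha> t)"
        by simp
      finally show ?thesis
        by (simp add: prod_uminus)
    qed
    then show ?thesis
      by (subst prod_add) (simp, rule sum.cong, simp_all)
  qed
  have zero: "(\<Prod>t<m. 1 + (- ((0 :: real) ^ \<alpha> t))) = of_bool (\<alpha> = ?one)" if "\<alpha> \<in> exponents m" for \<alpha>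
  proof (cases "\<forall>t<m. \<alpha> t \<noteq> 0")
    case True
    with exponents_positive_imp_one[OF that] have "\<alpha> = ?one" by blast
    then show ?thesis by simp
  next
    case False
    then obtain t where t: "t < m" "\<alpha> t = 0" by blast
    then have "\<alpha> \<noteq> ?one" by auto
    with t show ?thesis by (auto intro!: prod_zero bexI[of _ t])
  qed
  have one: "?one \<in> exponents m" by (simp add: exponents_def)
  have "(\<Sum>S\<in>Pow {..<m}. (- 1) ^ card ({..<m} - S) *
            (\<Sum>\<alpha>\<in>exponents m. c \<alpha> * (\<Prod>t<m. of_bool (t \<in> S) ^ \<alpha> t))) =
        (\<Sum>\<alpha>\<in>exponents m. c \<alpha> *
            (\<Sum>S\<in>Pow {..<m}. (- 1) ^ card ({..<m} - S) * (\<Prod>t<m. of_bool (t \<in> S) ^ \<alpha> t)))"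
    unfolding sum_distrib_left
    by (rule trans[OF sum.swap]) (intro sum.cong refl, simp only: mult.left_commute)
  also have "\<dots> = (\<Sum>\<alpha>\<in>exponents m. if \<alpha> = ?one then c \<alpha> else 0)"
    unfolding signed by (intro sum.cong refl, subst zero) simp_all
  also have "\<dots> = c ?one"
    using one by (simp add: finite_exponents)
  finally show ?thesis .
qed

lemma mixed_volume_eq:
  assumes "volume_polynomial m K c"
  shows "mixed_volume m K = c (\<lambda>t\<in>{..<m}. 1) / fact m"
proof -
  have coeff: "d (\<lambda>t\<in>{..<m}. 1) = (\<Sum>S\<in>Pow {..<m}. (- 1) ^ card ({..<m} - S) *
          lattice_volume m (minkowski_comb m (\<lambda>t. of_bool (t \<in> S)) K))"
    if "volume_polynomial m K d" for d
    using that squarefree_coefficient[of m d] by (simp add: volume_polynomial_def)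
  have unique: "d (\<lambda>t\<in>{..<m}. 1) = c (\<lambda>t\<in>{..<m}. 1)" if "volume_polynomial m K d" for d
    unfolding coeff[OF that] coeff[OF assms] ..
  show ?thesis
    unfolding mixed_volume_def
  proof (rule the_equality)
    fix v
    assume "\<exists>d. volume_polynomial m K d \<and> v = d (\<lambda>t\<in>{..<m}. 1) / fact m"
    then obtain d where d: "volume_polynomial m K d" "v = d (\<lambda>t\<in>{..<m}. 1) / fact m"
      by blast
    show "v = c (\<lambda>t\<in>{..<m}. 1) / fact m"
      unfolding d(2) unique[OF d(1)] ..
  qed (use assms in blast)
qed

text \<open>
  The argument is the list \<open>[b\<^sub>1, \<dots>, b\<^sub>m]\<close>, meaningful if its sum equals its length \<open>m\<close>. The list
  \<open>js\<close> of length \<open>m\<close> contains \<open>b\<^sub>j\<close> copies of each \<open>j\<close> with \<open>1 \<le> j \<le> m\<close>.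
\<close>

definition mixed_eulerian :: "nat list \<Rightarrow> real" where
  "mixed_eulerian b =
     (let m = length b;
          js = concat (map (\<lambda>j. replicate (b ! (j - 1)) j) [1..<Suc m])
      in fact m * mixed_volume m (\<lambda>t. hypersimplex0 m (js ! t)))"

definition mixed_eulerian_poly :: "nat list \<Rightarrow> real poly" where
  "mixed_eulerian_poly a =
     (let k = length a; r = sum_list a
      in \<Sum>i\<le>r - k. monom (mixed_eulerian (replicate i 0 @ a @ replicate (r - k - i) 0)) i)"

end

theory Submission
  imports Defs
begin

text \<open>
  The Minkowski combination of hypersimplices with weights \<open>l t\<close> and levels \<open>j t\<close> is the
  permutohedron of the decreasing vector \<open>x i = (\<Sum>t. l t * [i < j t])\<close>. Its slice at height \<open>s\<close>
  of one coordinate is the permutohedron in which \<open>x i\<close> and \<open>x (i + 1)\<close>, where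
  \<open>x (i + 1) \<le> s \<le> x i\<close>, are merged into \<open>x i + x (i + 1) - s\<close>; integrating over \<open>s\<close> shows that the
  volume is a homogeneous polynomial \<open>F\<close>, so mixed Eulerian numbers are its iterated differences
  along the vectors \<open>omega j\<close>.

  Moving \<open>x\<close> along the simple root \<open>alpha k = 2 * omega k - omega (k - 1) - omega (k + 1)\<close> relaxes
  only the inequalities of \<open>k\<close>-subsets \<open>S\<close> and adds one cap for each \<open>S\<close>; adding \<open>omega k\<close> to \<open>x\<close>
  translates the cap by the indicator vector of \<open>S\<close>. Hence differences of \<open>F\<close> along
  \<open>alpha k\<close> and \<open>omega k\<close> vanish, which for a multiset of levels containing \<open>k\<close> twice is the relation
  \<open>2 A(N + {k, k}) = A(N + {k - 1, k}) + A(N + {k + 1, k})\<close>. The coefficients of the right-hand side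
  satisfy the same relation, and a maximum principle shows that it has, up to scaling, only one
  solution on multisets whose support is an interval.
\<close>

section \<open>Homogeneous polynomial functions\<close>

text \<open>Homogeneity of degree \<open>d\<close> in the first \<open>n\<close> coordinates, given
  by generating rules so that substitution and integration can proceed by induction. The zero
  function counts as homogeneous of every degree.\<close>

inductive hpoly :: "nat \<Rightarrow> nat \<Rightarrow> ((nat \<Rightarrow> real) \<Rightarrow> real) \<Rightarrow> bool" for n where
  hpoly_const: "hpoly n 0 (\<lambda>_. c)"
| hpoly_zero: "hpoly n d (\<lambda>_. 0)"
| hpoly_mult: "j < n \<Longrightarrow> hpoly n d F \<Longrightarrow> hpoly n (Suc d) (\<lambda>u. u j * F u)"
| hpoly_add: "hpoly n d F \<Longrightarrow> hpoly n d G \<Longrightarrow> hpoly n d (\<lambda>u. F u + G u)"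

lemma hpoly_cmult: "hpoly n d F \<Longrightarrow> hpoly n d (\<lambda>u. c * F u)"
proof (induction rule: hpoly.induct)
  case (hpoly_mult j d F)
  then have "hpoly n (Suc d) (\<lambda>u. u j * (c * F u))" by (intro hpoly.hpoly_mult)
  then show ?case by (simp add: mult.left_commute)
next
  case (hpoly_add d F G)
  then show ?case using hpoly.hpoly_add[OF hpoly_add.IH] by (simp add: distrib_left)
qed (auto intro: hpoly.intros)

lemma hpoly_sum:
  assumes "finite A" "\<And>a. a \<in> A \<Longrightarrow> hpoly n d (F a)"
  shows "hpoly n d (\<lambda>u. \<Sum>a\<in>A. F a u)"
  using assms by (induction A rule: finite_induct) (auto intro: hpoly.intros)

lemma hpoly_power: "j < n \<Longrightarrow> hpoly n d (\<lambda>u. u j ^ d)"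
proof (induction d)
  case 0 show ?case using hpoly_const[of n 1] by simp
next
  case (Suc d) then show ?case using hpoly_mult[of j n d "\<lambda>u. u j ^ d"] by simp
qed

text \<open>Minkowski weights enter the vector of a permutohedron linearly, so a volume polynomial
  in the vector becomes one in the weights.\<close>

lemma hpoly_linear_subst:
  assumes "hpoly n d F"
  shows "hpoly m d (\<lambda>u. F (\<lambda>j. \<Sum>t<m. u t * L t j))"
  using assms
proof (induction rule: hpoly.induct)
  case (hpoly_mult j d F)
  have "hpoly m (Suc d) (\<lambda>u. \<Sum>t<m. L t j * (u t * F (\<lambda>j. \<Sum>t<m. u t * L t j)))"
    by (intro hpoly_sum hpoly_cmult hpoly.hpoly_mult hpoly_mult.IH) auto
  then show ?case by (simp add: sum_distrib_left sum_distrib_right mult_ac)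
qed (auto intro: hpoly.intros)

text \<open>Multiplication by \<open>u j\<close> shifts exponents: the new coefficient at \<alpha>
  is the old one at \<alpha> with the exponent of \<open>j\<close> lowered. The result has the form
  required by \<open>volume_polynomial\<close>.\<close>

lemma hpoly_monomials:
  assumes "hpoly n d F"
  shows "\<exists>c. \<forall>u. F u =
    (\<Sum>\<alpha>\<in>{\<alpha> \<in> {..<n} \<rightarrow>\<^sub>E {..d}. (\<Sum>t<n. \<alpha> t) = d}. c \<alpha> * (\<Prod>t<n. u t ^ \<alpha> t))"
    (is "\<exists>c. \<forall>u. F u = (\<Sum>\<alpha>\<in>?E d. c \<alpha> * ?m u \<alpha>)")
  using assms
proof (induction rule: hpoly.induct)
  case (hpoly_const c)
  have "?E 0 = {\<lambda>t\<in>{..<n}. 0}"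
    by (auto simp: fun_eq_iff PiE_def extensional_def)
  then show ?case by (intro exI[of _ "\<lambda>_. c"]) simp
next
  case (hpoly_zero d)
  show ?case by (intro exI[of _ "\<lambda>_. 0"]) simp
next
  case (hpoly_mult j d F)
  obtain c where c: "\<And>u. F u = (\<Sum>\<alpha>\<in>?E d. c \<alpha> * ?m u \<alpha>)"
    using hpoly_mult.IH by blast
  let ?up = "\<lambda>\<alpha>. \<alpha>(j := Suc (\<alpha> j))" and ?down = "\<lambda>\<alpha>. \<alpha>(j := \<alpha> j - 1)"
  let ?c = "\<lambda>\<alpha>. if \<alpha> j = 0 then 0 else c (?down \<alpha>)"
  \<comment> \<open>Additions on both sides avoid truncated subtraction of exponents.\<close>
  have sum_upd: "(\<Sum>t<n. (\<alpha>(j := v)) t) + \<alpha> j = (\<Sum>t<n. \<alpha> t) + v" for \<alpha> :: "nat \<Rightarrow> nat" and v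
    using sum.remove[of "{..<n}" j "\<alpha>(j := v)"] sum.remove[of "{..<n}" j \<alpha>] hpoly_mult(1) by simp
  have fin: "finite (?E e)" for e
    by (rule finite_subset[of _ "{..<n} \<rightarrow>\<^sub>E {..e}"]) (auto simp: finite_PiE)
  have le: "\<alpha> \<in> ?E e \<longleftrightarrow> \<alpha> \<in> extensional {..<n} \<and> (\<Sum>t<n. \<alpha> t) = e" for \<alpha> e
  proof -
    have "\<alpha> t \<le> (\<Sum>t<n. \<alpha> t)" if "t < n" for t
      using that by (intro member_le_sum) auto
    then show ?thesis by (auto simp: PiE_def Pi_def) 
  qed
  have "u j * F u = (\<Sum>\<alpha>\<in>?E (Suc d). ?c \<alpha> * ?m u \<alpha>)" for u
  proof -
    have "u j * F u = (\<Sum>\<alpha>\<in>?E d. c \<alpha> * ?m u (?up \<alpha>))"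
    proof -
      have "?m u (?up \<alpha>) = u j * ?m u \<alpha>" for \<alpha>
        using prod.remove[of "{..<n}" j "\<lambda>t. u t ^ ?up \<alpha> t"]
          prod.remove[of "{..<n}" j "\<lambda>t. u t ^ \<alpha> t"] hpoly_mult(1) by simp
      then show ?thesis by (simp add: c sum_distrib_left mult_ac)
    qed
    also have "\<dots> = (\<Sum>\<alpha>\<in>{\<alpha> \<in> ?E (Suc d). \<alpha> j \<noteq> 0}. ?c \<alpha> * ?m u \<alpha>)"
    proof (rule sum.reindex_bij_witness[of _ ?down ?up])
      fix \<alpha> assume a: "\<alpha> \<in> {\<alpha> \<in> ?E (Suc d). \<alpha> j \<noteq> 0}"
      then show "?down \<alpha> \<in> ?E d"
        unfolding le mem_Collect_eq using sum_upd[of \<alpha> "\<alpha> j - 1"] hpoly_mult(1)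
        by (auto simp: extensional_def)
    next
      fix \<alpha> assume a: "\<alpha> \<in> ?E d"
      then show "?up \<alpha> \<in> {\<alpha> \<in> ?E (Suc d). \<alpha> j \<noteq> 0}"
        unfolding le mem_Collect_eq using sum_upd[of \<alpha> "Suc (\<alpha> j)"] hpoly_mult(1)
        by (auto simp: extensional_def)
    qed auto
    also have "\<dots> = (\<Sum>\<alpha>\<in>?E (Suc d). ?c \<alpha> * ?m u \<alpha>)"
      by (rule sum.mono_neutral_left) (auto simp: fin)
    finally show ?thesis .
  qed
  then show ?case by (intro exI[of _ ?c]) auto
next
  case (hpoly_add d F G)
  then obtain c c' where "\<And>u. F u = (\<Sum>\<alpha>\<in>?E d. c \<alpha> * ?m u \<alpha>)" "\<And>u. G u = (\<Sum>\<alpha>\<in>?E d. c' \<alpha> * ?m u \<alpha>)"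
    by blast
  then show ?case
    by (intro exI[of _ "\<lambda>\<alpha>. c \<alpha> + c' \<alpha>"]) (simp add: sum.distrib algebra_simps)
qed

lemma exponents_eq: "exponents m = {\<alpha> \<in> {..<m} \<rightarrow>\<^sub>E {..m}. (\<Sum>t<m. \<alpha> t) = m}"
proof -
  have "\<alpha> t \<le> (\<Sum>t<m. \<alpha> t)" if "t < m" for \<alpha> :: "nat \<Rightarrow> nat" and t
    using that by (intro member_le_sum) auto
  then show ?thesis by (auto simp: exponents_def PiE_def Pi_def) metis
qed

section \<open>Integration over the height of a slice\<close>

definition merge_at :: "nat \<Rightarrow> real \<Rightarrow> (nat \<Rightarrow> real) \<Rightarrow> nat \<Rightarrow> real" where
  "merge_at i s x j = (if j < i then x j else if j = i then x i + x (Suc i) - s else x (Suc j))"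

text \<open>The variable \<open>s\<close> enters \<open>merge_at i s x\<close> only through
  coordinate \<open>i\<close>, so every factor of \<open>F\<close> at that coordinate contributes
  one more power of \<open>x i + x (Suc i) - s\<close>. Carrying the power \<open>e\<close> along
  closes the induction.\<close>

lemma hpoly_integral_aux:
  assumes "hpoly n d F" "i < n"
  shows "\<exists>G. hpoly (Suc n) (Suc (d + e)) G \<and> (\<forall>x. x (Suc i) \<le> x i \<longrightarrow>
    ((\<lambda>s. (x i + x (Suc i) - s) ^ e * F (merge_at i s x)) has_integral G x) {x (Suc i)..x i})"
  using assms
proof (induction arbitrary: e rule: hpoly.induct)
  case (hpoly_const c)
  \<comment> \<open>The reflection of \<open>s\<close> to \<open>x i + x (Suc i) - s\<close> maps
    the interval onto itself, so this is \<open>c\<close> times the integral of the power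
    \<open>e\<close> over it.\<close>
  let ?G = "\<lambda>x. c / real (Suc e) * (x i ^ Suc e + (-1) * x (Suc i) ^ Suc e)"
  have "hpoly (Suc n) (Suc e) ?G"
    using hpoly_const by (intro hpoly_cmult hpoly_add hpoly_power) auto
  moreover have "((\<lambda>s. (x i + x (Suc i) - s) ^ e * c) has_integral ?G x) {x (Suc i)..x i}"
    if "x (Suc i) \<le> x i" for x
  proof -
    have "((\<lambda>s. (x i + x (Suc i) - s) ^ e * c) has_integral
        - (c / real (Suc e) * (x i + x (Suc i) - x i) ^ Suc e) - - (c / real (Suc e) * (x i + x (Suc i) - x (Suc i)) ^ Suc e)) {x (Suc i)..x i}"
      using that
      by (intro fundamental_theorem_of_calculus)
        (auto simp flip: has_real_derivative_iff_has_vector_derivative simp del: power_Suc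
          intro!: derivative_eq_intros)
    then show ?thesis by (simp add: algebra_simps)
  qed
  ultimately show ?case by (intro exI[of _ ?G]) simp
next
  case (hpoly_zero d)
  show ?case by (intro exI[of _ "\<lambda>_. 0"]) (auto intro: hpoly.intros)
next
  case (hpoly_mult j d F)
  have mi: "merge_at i s x i = x i + x (Suc i) - s" for s x by (simp add: merge_at_def)
  show ?case
  proof (cases "j = i")
    case True
    obtain G where G: "hpoly (Suc n) (Suc (d + Suc e)) G"
      "\<And>x. x (Suc i) \<le> x i \<Longrightarrow>
        ((\<lambda>s. (x i + x (Suc i) - s) ^ Suc e * F (merge_at i s x)) has_integral G x) {x (Suc i)..x i}"
      using hpoly_mult.IH[of "Suc e"] hpoly_mult.prems by blast
    then show ?thesis
      by (intro exI[of _ G]) (simp add: True mi mult_ac)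
  next
    case False
    \<comment> \<open>Any other coordinate of the merged vector is a coordinate of \<open>x\<close>,
      constant in \<open>s\<close>, and moves out of the integral.\<close>
    define j' where "j' = (if j < i then j else Suc j)"
    have j': "merge_at i s x j = x j'" for s x
      using False by (simp add: merge_at_def j'_def)
    obtain G where G: "hpoly (Suc n) (Suc (d + e)) G"
      "\<And>x. x (Suc i) \<le> x i \<Longrightarrow>
        ((\<lambda>s. (x i + x (Suc i) - s) ^ e * F (merge_at i s x)) has_integral G x) {x (Suc i)..x i}"
      using hpoly_mult.IH[of e] hpoly_mult.prems by blast
    have "hpoly (Suc n) (Suc (Suc d + e)) (\<lambda>x. x j' * G x)"
      using hpoly.hpoly_mult[OF _ G(1), of j'] hpoly_mult.hyps by (simp add: j'_def)
    moreover have "((\<lambda>s. (x i + x (Suc i) - s) ^ e * (merge_at i s x j * F (merge_at i s x)))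
        has_integral x j' * G x) {x (Suc i)..x i}" if "x (Suc i) \<le> x i" for x
      using has_integral_mult_right[OF G(2)[OF that], of "x j'"] by (simp add: j' mult_ac)
    ultimately show ?thesis by blast
  qed
next
  case (hpoly_add d F G)
  obtain F' where F': "hpoly (Suc n) (Suc (d + e)) F'" "\<And>x. x (Suc i) \<le> x i \<Longrightarrow>
        ((\<lambda>s. (x i + x (Suc i) - s) ^ e * F (merge_at i s x)) has_integral F' x) {x (Suc i)..x i}"
      using hpoly_add.IH(1)[OF hpoly_add.prems, of e] by blast
  obtain G' where G': "hpoly (Suc n) (Suc (d + e)) G'" "\<And>x. x (Suc i) \<le> x i \<Longrightarrow>
        ((\<lambda>s. (x i + x (Suc i) - s) ^ e * G (merge_at i s x)) has_integral G' x) {x (Suc i)..x i}"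
      using hpoly_add.IH(2)[OF hpoly_add.prems, of e] by blast
  have "((\<lambda>s. (x i + x (Suc i) - s) ^ e * (F (merge_at i s x) + G (merge_at i s x)))
      has_integral F' x + G' x) {x (Suc i)..x i}" if "x (Suc i) \<le> x i" for x
    using has_integral_add[OF F'(2)[OF that] G'(2)[OF that]] by (simp add: distrib_left)
  then show ?case
    using hpoly.hpoly_add[OF F'(1) G'(1)] by blast
qed

lemma hpoly_integral:
  assumes "hpoly n d F" "i < n"
  obtains G where "hpoly (Suc n) (Suc d) G"
    "\<And>x. x (Suc i) \<le> x i \<Longrightarrow> ((\<lambda>s. F (merge_at i s x)) has_integral G x) {x (Suc i)..x i}"
  using hpoly_integral_aux[OF assms, of 0] by auto

section \<open>Iterated differences\<close>

text \<open>Polynomials of degree at most \<open>d\<close>; in contrast to \<open>hpoly\<close>, a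
  class closed under translation and hence suited to differences.\<close>

inductive dpoly :: "nat \<Rightarrow> ((nat \<Rightarrow> real) \<Rightarrow> real) \<Rightarrow> bool" where
  dpoly_const: "dpoly d (\<lambda>_. c)"
| dpoly_mult: "dpoly d F \<Longrightarrow> dpoly (Suc d) (\<lambda>u. u j * F u)"
| dpoly_add: "dpoly d F \<Longrightarrow> dpoly d G \<Longrightarrow> dpoly d (\<lambda>u. F u + G u)"

lemma hpoly_imp_dpoly: "hpoly n d F \<Longrightarrow> dpoly d F"
  by (induction rule: hpoly.induct) (auto intro: dpoly.intros)

lemma dpoly_Suc: "dpoly d F \<Longrightarrow> dpoly (Suc d) F"
  by (induction rule: dpoly.induct) (auto intro: dpoly.intros)

lemma dpoly_cmult: "dpoly d F \<Longrightarrow> dpoly d (\<lambda>u. c * F u)"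
proof (induction rule: dpoly.induct)
  case (dpoly_mult d F j)
  then show ?case using dpoly.dpoly_mult[OF dpoly_mult.IH, of j] by (simp add: mult.left_commute)
next
  case (dpoly_add d F G)
  then show ?case using dpoly.dpoly_add[OF dpoly_add.IH] by (simp add: distrib_left)
qed (auto intro: dpoly.intros)

lemma dpoly_translate: "dpoly d F \<Longrightarrow> dpoly d (\<lambda>u. F (\<lambda>i. u i + v i))"
proof (induction rule: dpoly.induct)
  case (dpoly_mult d F j)
  have "dpoly (Suc d) (\<lambda>u. u j * F (\<lambda>i. u i + v i) + v j * F (\<lambda>i. u i + v i))"
    by (intro dpoly.intros dpoly_mult.IH dpoly_Suc dpoly_cmult)
  then show ?case by (simp add: distrib_right)
qed (auto intro: dpoly.intros)

text \<open>Each difference lowers the degree by one. As \<open>d - 1\<close> truncates, the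
  vanishing of differences of constants is recorded in a conjunct of its own.\<close>

lemma dpoly_difference:
  "dpoly d F \<Longrightarrow> dpoly (d - 1) (\<lambda>u. F (\<lambda>i. u i + v i) - F u) \<and> (d = 0 \<longrightarrow> (\<forall>u. F (\<lambda>i. u i + v i) = F u))"
proof (induction rule: dpoly.induct)
  case (dpoly_const d c)
  show ?case using dpoly.dpoly_const[of "d - 1" 0] by simp
next
  case (dpoly_mult d F j)
  have *: "(u j + v j) * F (\<lambda>i. u i + v i) - u j * F u
      = u j * (F (\<lambda>i. u i + v i) - F u) + v j * F (\<lambda>i. u i + v i)" for u
    by (simp add: algebra_simps)
  have "dpoly d (\<lambda>u. v j * F (\<lambda>i. u i + v i))"
    by (intro dpoly_cmult dpoly_translate dpoly_mult.hyps)
  moreover have "dpoly d (\<lambda>u. u j * (F (\<lambda>i. u i + v i) - F u))"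
  proof (cases d)
    case 0
    then show ?thesis using dpoly_mult.IH dpoly.dpoly_const[of 0 0] by simp
  next
    case (Suc d')
    then show ?thesis using dpoly.dpoly_mult[of d' _ j] dpoly_mult.IH by simp
  qed
  ultimately show ?case unfolding * using dpoly.dpoly_add by auto
next
  case (dpoly_add d F G)
  then have "dpoly (d - 1) (\<lambda>u. (F (\<lambda>i. u i + v i) - F u) + (G (\<lambda>i. u i + v i) - G u))"
    by (intro dpoly.dpoly_add) auto
  then show ?case using dpoly_add.IH by (simp add: algebra_simps)
qed

text \<open>The iterated difference of \<open>F\<close> at \<open>x\<close> with one step
  \<open>v t\<close> for each \<open>t\<close> in \<open>N\<close>, expanded by inclusion-exclusion
  and thus visibly independent of the order of the steps. For a homogeneous polynomial
  \<open>F\<close> of degree \<open>card N\<close> and \<open>x = 0\<close> it is the coefficient of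
  the squarefree monomial in the weights of a combination of the \<open>v t\<close>.\<close>

definition polarize ::
    "((nat \<Rightarrow> real) \<Rightarrow> real) \<Rightarrow> (nat \<Rightarrow> real) \<Rightarrow> (nat \<Rightarrow> nat \<Rightarrow> real) \<Rightarrow> nat set \<Rightarrow> real" where
  "polarize F x v N = (\<Sum>S\<in>Pow N. (- 1) ^ card (N - S) * F (\<lambda>i. x i + (\<Sum>t\<in>S. v t i)))"

lemma polarize_cong:
  assumes "\<And>t. t \<in> N \<Longrightarrow> v t = w t"
  shows "polarize F x v N = polarize F x w N"
  unfolding polarize_def using assms by (intro sum.cong arg_cong2[of _ _ _ _ "(*)"] arg_cong[of _ _ F] ext) (auto intro!: sum.cong)

lemma polarize_insert:
  assumes "finite N" "t \<notin> N"
  shows "polarize F x v (insert t N) = polarize F (\<lambda>i. x i + v t i) v N - polarize F x v N"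
proof -
  have split: "Pow (insert t N) = Pow N \<union> insert t ` Pow N" by (rule Pow_insert)
  have inj: "inj_on (insert t) (Pow N)" using assms by (auto simp: inj_on_def)
  have "polarize F x v (insert t N) =
     (\<Sum>S\<in>Pow N. (- 1) ^ card (insert t N - S) * F (\<lambda>i. x i + (\<Sum>t\<in>S. v t i))) +
     (\<Sum>S\<in>Pow N. (- 1) ^ card (insert t N - insert t S) * F (\<lambda>i. x i + (\<Sum>t\<in>insert t S. v t i)))"
    unfolding polarize_def split
    by (subst sum.union_disjoint) (use assms in \<open>auto simp: sum.reindex[OF inj]\<close>)
  also have "(\<Sum>S\<in>Pow N. (- 1) ^ card (insert t N - S) * F (\<lambda>i. x i + (\<Sum>t\<in>S. v t i)))
     = - polarize F x v N"
    unfolding polarize_def sum_negf[symmetric]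
  proof (intro sum.cong refl)
    fix S assume S: "S \<in> Pow N"
    then have "insert t N - S = insert t (N - S)" using assms by auto
    then have "card (insert t N - S) = Suc (card (N - S))" using assms by simp
    then show "(- 1) ^ card (insert t N - S) * F (\<lambda>i. x i + (\<Sum>t\<in>S. v t i)) =
       - ((- 1) ^ card (N - S) * F (\<lambda>i. x i + (\<Sum>t\<in>S. v t i)))" by simp
  qed
  also have "(\<Sum>S\<in>Pow N. (- 1) ^ card (insert t N - insert t S) * F (\<lambda>i. x i + (\<Sum>t\<in>insert t S. v t i)))
     = polarize F (\<lambda>i. x i + v t i) v N"
    unfolding polarize_def
  proof (intro sum.cong refl)
    fix S assume S: "S \<in> Pow N"
    then have "insert t N - insert t S = N - S" "t \<notin> S" "finite S"
      using assms finite_subset by auto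
    then show "(- 1) ^ card (insert t N - insert t S) * F (\<lambda>i. x i + (\<Sum>t\<in>insert t S. v t i)) =
       (- 1) ^ card (N - S) * F (\<lambda>i. x i + v t i + (\<Sum>t\<in>S. v t i))" by (simp add: add.assoc)
  qed
  finally show ?thesis by simp
qed

lemma polarize_difference:
  "polarize F (\<lambda>i. x i + w i) v N - polarize F x v N =
   polarize (\<lambda>u. F (\<lambda>i. u i + w i) - F u) x v N"
  unfolding polarize_def by (simp add: algebra_simps sum_subtractf)

lemma polarize_vanishes:
  assumes "finite N" "dpoly d F" "d < card N"
  shows "polarize F x v N = 0"
  using assms
proof (induction N arbitrary: F d rule: finite_induct)
  case empty then show ?case by simp
next
  case (insert t N)
  let ?D = "\<lambda>u. F (\<lambda>i. u i + v t i) - F u"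
  have *: "polarize F x v (insert t N) = polarize ?D x v N"
    using insert.hyps by (simp add: polarize_insert polarize_difference)
  show ?case
  proof (cases "d = 0")
    case True
    then have "?D = (\<lambda>_. 0)" using dpoly_difference[OF insert.prems(1), of "v t"] by auto
    then show ?thesis unfolding * by (simp add: polarize_def)
  next
    case False
    then show ?thesis unfolding *
      using insert dpoly_difference[OF insert.prems(1), of "v t"] by (intro insert.IH[of "d - 1"]) auto
  qed
qed

text \<open>After as many differences as the degree minus one, an affine function of the base point
  remains, so its increment along \<open>w\<close> is the same everywhere. In the proof, one more
  difference along \<open>x\<close> exhausts the degree.\<close>

lemma polarize_affine:
  assumes "finite N" "dpoly (Suc (card N)) F"
  shows "polarize F (\<lambda>i. x i + w i) v N - polarize F x v N =
    polarize F w v N - polarize F (\<lambda>_. 0) v N"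
proof -
  let ?D = "\<lambda>u. F (\<lambda>i. u i + w i) - F u"
  let ?DD = "\<lambda>u. ?D (\<lambda>i. u i + x i) - ?D u"
  have D: "dpoly (card N) ?D" using dpoly_difference[OF assms(2)] by simp
  have "polarize ?D x v N - polarize ?D (\<lambda>_. 0) v N = polarize ?DD (\<lambda>_. 0) v N"
    using polarize_difference[of ?D "\<lambda>_. 0" x v N] by simp
  also have "\<dots> = 0"
  \<comment> \<open>Without directions the degree is already exhausted, and
    \<open>card N - 1\<close> would not be a smaller degree.\<close>
  proof (cases "card N = 0")
    case True
    then have "?DD = (\<lambda>_. 0)" using dpoly_difference[OF D, of x] by auto
    then show ?thesis by (simp add: polarize_def)
  next
    case False
    then show ?thesis using dpoly_difference[OF D, of x] assms(1)
      by (intro polarize_vanishes[of _ "card N - 1"]) (auto simp: card_gt_0_iff intro!: diff_less)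
  qed
  finally show ?thesis
    using polarize_difference[of F x w v N] polarize_difference[of F "\<lambda>_. 0" w v N] by simp
qed

text \<open>This symmetry allows sequences of levels to be replaced by multisets.\<close>

lemma polarize_permute:
  assumes "bij_betw \<pi> N N"
  shows "polarize F x (\<lambda>t. v (\<pi> t)) N = polarize F x v N"
  unfolding polarize_def
proof (rule sum.reindex_bij_witness[of _ "\<lambda>S. inv_into N \<pi> ` S" "\<lambda>S. \<pi> ` S"])
  have inj: "inj_on \<pi> N" and img: "\<pi> ` N = N" using assms by (auto simp: bij_betw_def)
  fix S assume S: "S \<in> Pow N"
  show "inv_into N \<pi> ` \<pi> ` S = S" using S inj by (simp add: inv_into_image_cancel)
  show "\<pi> ` S \<in> Pow N" using S img by auto
  show "\<pi> ` inv_into N \<pi> ` S = S" using S img by (simp add: image_inv_into_cancel)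
  show "inv_into N \<pi> ` S \<in> Pow N" using S img inv_into_into[of _ \<pi> N] by auto
  have "card (N - \<pi> ` S) = card (\<pi> ` (N - S))" 
    using S inj by (subst inj_on_image_set_diff[OF inj]) (auto simp: img)
  also have "\<dots> = card (N - S)" using inj by (simp add: card_image inj_on_diff)
  finally show "(- 1) ^ card (N - \<pi> ` S) * F (\<lambda>i. x i + (\<Sum>t\<in>\<pi> ` S. v t i)) =
         (- 1) ^ card (N - S) * F (\<lambda>i. x i + (\<Sum>t\<in>S. v (\<pi> t) i))"
    using S inj by (simp add: sum.reindex inj_on_subset)
qed

section \<open>Volumes of permutohedra\<close>

text \<open>For decreasing \<open>x\<close> this is the largest sum of \<open>k\<close> entries, the
  support number of the permutohedron of \<open>x\<close> for sets of size \<open>k\<close>.\<close>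

definition psum :: "(nat \<Rightarrow> real) \<Rightarrow> nat \<Rightarrow> real" where
  "psum x k = (\<Sum>j<k. x j)"

lemma psum_0 [simp]: "psum x 0 = 0" and psum_Suc [simp]: "psum x (Suc k) = psum x k + x k"
  by (simp_all add: psum_def)

text \<open>The parameter counts steps: the \<open>n + 1\<close> entries \<open>x 0\<close>, ...,
  \<open>x n\<close> are compared.\<close>

definition decr :: "nat \<Rightarrow> (nat \<Rightarrow> real) \<Rightarrow> bool" where
  "decr n x \<longleftrightarrow> (\<forall>j<n. x (Suc j) \<le> x j)"

lemma decr_le:
  assumes "decr n x" "a \<le> b" "b \<le> n"
  shows "x b \<le> x a"
  using assms(2)
proof (induction rule: inc_induct)
  case (step i)
  then have "x (Suc i) \<le> x i" using assms by (simp add: decr_def)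
  then show ?case using step.IH by linarith
qed simp

text \<open>
  The permutohedron with support numbers \<open>h\<close> on one more coordinate than \<open>I\<close>, projected to \<open>I\<close>: the
  lower bounds are the upper bounds for the sets containing the forgotten coordinate.
\<close>

definition shadow :: "nat set \<Rightarrow> (nat \<Rightarrow> real) \<Rightarrow> (nat \<Rightarrow> real) set" where
  "shadow I h = {z \<in> extensional I. \<forall>S\<subseteq>I. sum z S \<le> h (card S) \<and>
     h (Suc (card I)) - h (Suc (card I) - card S) \<le> sum z S}"

lemma shadow_cong:
  assumes "finite I" "\<And>k. k \<le> Suc (card I) \<Longrightarrow> h k = h' k"
  shows "shadow I h = shadow I h'"
proof -
  have "card S \<le> Suc (card I)" if "S \<subseteq> I" for S using card_mono[OF assms(1) that] by simp
  then show ?thesis using assms(2) by (auto simp: shadow_def)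
qed

lemma shadow_insert:
  assumes I: "finite I" "a \<notin> I" and z: "z \<in> extensional I" and h0: "h 0 = 0"
  defines "n \<equiv> Suc (card I)"
  shows "z(a := s) \<in> shadow (insert a I) h \<longleftrightarrow>
    h (Suc n) - h n \<le> s \<and> s \<le> h 1 \<and> z \<in> shadow I (\<lambda>k. min (h k) (h (Suc k) - s))"
    (is "?L \<longleftrightarrow> _ \<and> _ \<and> ?R")
proof -
  have card: "card (insert a I) = n" using I by (simp add: n_def)
  have without: "sum (z(a := s)) S = sum z S" "card S < n" if "S \<subseteq> I" for S
  proof -
    show "sum (z(a := s)) S = sum z S" using that I by (intro sum.cong) auto
    show "card S < n" using card_mono[OF I(1) that] by (simp add: n_def)
  qed
  have "with": "sum (z(a := s)) (insert a S) = s + sum z S" "card (insert a S) = Suc (card S)"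
    if "S \<subseteq> I" for S
  proof -
    have "finite S" "a \<notin> S" using that I finite_subset by auto
    then show "sum (z(a := s)) (insert a S) = s + sum z S" "card (insert a S) = Suc (card S)"
      using without[OF that] by simp_all
  qed
  show ?thesis
  proof
    assume L: ?L
    have *: "sum (z(a := s)) S \<le> h (card S)" "h (Suc n) - h (Suc n - card S) \<le> sum (z(a := s)) S"
      if "S \<subseteq> insert a I" for S
      using L that unfolding shadow_def card by auto
    \<comment> \<open>The first bound makes \<open>h (Suc n) - s\<close> the minimum at index
      \<open>n\<close>, so it is the coordinate total of the slice.\<close>
    have "h (Suc n) - h n \<le> s" "s \<le> h 1" using *[of "{a}"] by auto
    moreover have "sum z S \<le> min (h (card S)) (h (Suc (card S)) - s) \<and>
      min (h n) (h (Suc n) - s) - min (h (n - card S)) (h (Suc (n - card S)) - s) \<le> sum z S"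
      if "S \<subseteq> I" for S
    proof -
      have "S \<subseteq> insert a I" "insert a S \<subseteq> insert a I" "card S < n" using that without by auto
      then show ?thesis
        using *[of S] *[of "insert a S"] without[OF that] "with"[OF that] \<open>h (Suc n) - h n \<le> s\<close>
        by (simp add: Suc_diff_le)
    qed
    ultimately show "h (Suc n) - h n \<le> s \<and> s \<le> h 1 \<and> ?R"
      using z by (simp add: shadow_def n_def)
  next
    assume R: "h (Suc n) - h n \<le> s \<and> s \<le> h 1 \<and> ?R"
    then have *: "sum z S \<le> min (h (card S)) (h (Suc (card S)) - s)"
      "min (h n) (h (Suc n) - s) - min (h (n - card S)) (h (Suc (n - card S)) - s) \<le> sum z S"
      if "S \<subseteq> I" for S
      using that unfolding shadow_def n_def by auto
    have "sum (z(a := s)) S \<le> h (card S) \<and> h (Suc n) - h (Suc n - card S) \<le> sum (z(a := s)) S"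
      if S: "S \<subseteq> insert a I" for S
    proof (cases "a \<in> S")
      case True
      define T where "T = S - {a}"
      then have T: "S = insert a T" "T \<subseteq> I" using S True by auto
      then show ?thesis using *[of T] "with"[of T] R by auto
    next
      case False
      then have "S \<subseteq> I" using S by auto
      then show ?thesis using *[of S] without[of S] R by (auto simp: Suc_diff_le)
    qed
    then show ?L using z by (auto simp: shadow_def card extensional_def)
  qed
qed

lemma decr_merge_at:
  assumes "decr (Suc m) x" "x (Suc i) \<le> s" "s \<le> x i" "i \<le> m"
  shows "decr m (merge_at i s x)"
proof -
  have *: "x (Suc j) \<le> x j" if "j \<le> m" for j using assms(1) that by (simp add: decr_def)
  have "merge_at i s x (Suc j) \<le> merge_at i s x j" if "j < m" for j
  proof (cases "Suc j = i")
    case True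
    then show ?thesis using *[of j] assms that by (auto simp: merge_at_def)
  next
    case False
    then show ?thesis using *[of j] *[of "Suc j"] assms that by (auto simp: merge_at_def)
  qed
  then show ?thesis by (simp add: decr_def)
qed

text \<open>The entry \<open>x k\<close> is at least \<open>s\<close> for \<open>k\<close> up to
  \<open>i\<close> and at most \<open>s\<close> beyond, which decides the minimum. The support
  numbers of a slice are therefore again partial sums of a decreasing vector.\<close>

lemma psum_merge_at:
  assumes "decr (Suc m) x" "x (Suc i) \<le> s" "s \<le> x i" "i \<le> m" "k \<le> Suc m"
  shows "min (psum x k) (psum x (Suc k) - s) = psum (merge_at i s x) k"
proof (cases "k \<le> i")
  case True
  then have "psum (merge_at i s x) k = psum x k" by (auto simp: psum_def merge_at_def)
  moreover have "x i \<le> x k" using decr_le[OF assms(1)] True assms by auto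
  ultimately show ?thesis using assms by simp
next
  case False
  then have "Suc i \<le> k" by simp
  then have "psum (merge_at i s x) k = psum x (Suc k) - s"
  proof (induction k rule: dec_induct)
    case base
    have "psum (merge_at i s x) i = psum x i" "merge_at i s x i = x i + x (Suc i) - s"
      by (auto simp: psum_def merge_at_def)
    then show ?case by simp
  next
    case (step k) then show ?case by (simp add: merge_at_def)
  qed
  moreover have "x k \<le> x (Suc i)" using decr_le[OF assms(1)] False assms by auto
  ultimately show ?thesis using assms by simp
qed

lemma decr_interval_cover:
  assumes "decr (Suc m) x" "x (Suc m) \<le> s" "s \<le> x 0"
  obtains i where "i \<le> m" "x (Suc i) \<le> s" "s \<le> x i"
proof -
  have "\<exists>i\<le>m. x (Suc i) \<le> s \<and> s \<le> x i"
    using assms(2)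
  proof (induction m)
    case 0 then show ?case using assms(3) by auto
  next
    case (Suc m)
    then show ?case
      by (cases "x (Suc m) \<le> s") (auto intro: le_SucI exI[of _ "Suc m"])
  qed
  then show thesis using that by blast
qed

lemma has_integral_decr_intervals:
  fixes g :: "real \<Rightarrow> real"
  assumes "decr (Suc m) x" "\<And>i. i \<le> m \<Longrightarrow> (g has_integral G i) {x (Suc i)..x i}"
  shows "(g has_integral (\<Sum>i\<le>m. G i)) {x (Suc m)..x 0}"
  using assms
proof (induction m)
  case 0 then show ?case by simp
next
  case (Suc m)
  have "(g has_integral G (Suc m) + (\<Sum>i\<le>m. G i)) {x (Suc (Suc m))..x 0}"
  proof (rule has_integral_combine)
    show "x (Suc (Suc m)) \<le> x (Suc m)" "x (Suc m) \<le> x 0"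
      using decr_le[OF Suc.prems(1)] by auto
    show "(g has_integral G (Suc m)) {x (Suc (Suc m))..x (Suc m)}" using Suc.prems(2) by simp
    show "(g has_integral sum G {..m}) {x (Suc m)..x 0}"
      using Suc.prems by (intro Suc.IH) (auto simp: decr_def)
  qed
  then show ?case by (simp add: add.commute)
qed

section \<open>Measurability and integration over slices\<close>

lemma sets_shadow:
  assumes "finite I"
  shows "shadow I h \<in> sets (Pi\<^sub>M I (\<lambda>_. lborel))"
proof -
  have "shadow I h = {z \<in> space (Pi\<^sub>M I (\<lambda>_. lborel)). \<forall>S\<in>Pow I.
     sum z S \<le> h (card S) \<and> h (Suc (card I)) - h (Suc (card I) - card S) \<le> sum z S}"
    by (auto simp: shadow_def space_PiM PiE_def)
  also have "\<dots> \<in> sets (Pi\<^sub>M I (\<lambda>_. lborel))"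
  proof (rule sets.sets_Collect_finite_All)
    fix S assume "S \<in> Pow I"
    then have [measurable]: "(\<lambda>z. sum z S) \<in> borel_measurable (Pi\<^sub>M I (\<lambda>_. lborel))"
      using measurable_component_singleton[of _ I "\<lambda>_. lborel"] by (intro borel_measurable_sum) auto
    show "{z \<in> space (Pi\<^sub>M I (\<lambda>_. lborel)). sum z S \<le> h (card S) \<and>
        h (Suc (card I)) - h (Suc (card I) - card S) \<le> sum z S} \<in> sets (Pi\<^sub>M I (\<lambda>_. lborel))"
      by measurable
  qed (simp add: assms)
  finally show ?thesis .
qed

text \<open>Fubini in the last coordinate \<open>s\<close>, which runs from \<open>x (Suc m)\<close>
  to \<open>x 0\<close>; on each interval between neighbouring entries the slice is the
  permutohedron of a merged vector.\<close>

lemma volume_shadow_Suc: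
  fixes F :: "(nat \<Rightarrow> real) \<Rightarrow> real"
  assumes F: "\<And>x. decr m x \<Longrightarrow> 0 \<le> F x \<and>
      emeasure (Pi\<^sub>M {..<m} (\<lambda>_. lborel)) (shadow {..<m} (psum x)) = ennreal (F x)"
    and G: "\<And>i x. i \<le> m \<Longrightarrow> x (Suc i) \<le> x i \<Longrightarrow>
      ((\<lambda>s. F (merge_at i s x)) has_integral G i x) {x (Suc i)..x i}"
    and x: "decr (Suc m) x"
  shows "0 \<le> (\<Sum>i\<le>m. G i x) \<and>
    emeasure (Pi\<^sub>M {..<Suc m} (\<lambda>_. lborel)) (shadow {..<Suc m} (psum x)) = ennreal (\<Sum>i\<le>m. G i x)"
proof -
  interpret product_sigma_finite "\<lambda>_::nat. lborel :: real measure" by standard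
  let ?M = "\<lambda>I. Pi\<^sub>M I (\<lambda>_::nat. lborel :: real measure)"
  define A where "A = shadow (insert m {..<m}) (psum x)"
  define \<phi> where "\<phi> s = (\<integral>\<^sup>+ z. indicator A (z(m := s)) \<partial>?M {..<m})" for s
  \<comment> \<open>The integrand is taken from the slices themselves, so that it is one function on
    all intervals, whereas \<open>F (merge_at i s x)\<close> mentions \<open>i\<close>.\<close>
  define g where "g s = enn2real (\<phi> s)" for s
  have A[measurable]: "A \<in> sets (?M (insert m {..<m}))" unfolding A_def by (rule sets_shadow) simp
  have upd[measurable]: "(\<lambda>(s, z). z(m := s)) \<in> lborel \<Otimes>\<^sub>M ?M {..<m} \<rightarrow>\<^sub>M ?M (insert m {..<m})"
    using measurable_compose[OF measurable_pair_swap' measurable_add_dim[of m "{..<m}" "\<lambda>_. lborel"]]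
    by (simp add: case_prod_unfold)
  have "(\<lambda>p. indicator A ((\<lambda>(s, z). z(m := s)) p) :: ennreal) \<in> borel_measurable (lborel \<Otimes>\<^sub>M ?M {..<m})"
    by (rule measurable_compose[OF upd]) measurable
  then have \<phi>_meas[measurable]: "\<phi> \<in> borel_measurable lborel"
    unfolding \<phi>_def
    by (intro sigma_finite_measure.borel_measurable_nn_integral sigma_finite) (simp_all add: case_prod_unfold)
  have slice: "indicator A (z(m := s)) =
      (indicator {x (Suc m)..x 0} s * indicator (shadow {..<m} (\<lambda>k. min (psum x k) (psum x (Suc k) - s))) z :: ennreal)"
    if "z \<in> space (?M {..<m})" for z s
    using that shadow_insert[of "{..<m}" m z "psum x" s]
    by (auto simp: A_def space_PiM PiE_def indicator_def)
  have \<phi>_eq: "\<phi> s = ennreal (F (merge_at i s x)) \<and> 0 \<le> F (merge_at i s x)"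
    if i: "i \<le> m" "x (Suc i) \<le> s" "s \<le> x i" for i s
  proof -
    have "x (Suc m) \<le> x (Suc i)" "x i \<le> x 0" using decr_le[OF x] i by auto
    then have s: "s \<in> {x (Suc m)..x 0}" using i by auto
    have "\<phi> s = (\<integral>\<^sup>+ z. indicator (shadow {..<m} (\<lambda>k. min (psum x k) (psum x (Suc k) - s))) z \<partial>?M {..<m})"
      unfolding \<phi>_def by (rule nn_integral_cong) (use s in \<open>simp add: slice\<close>)
    also have "\<dots> = emeasure (?M {..<m}) (shadow {..<m} (\<lambda>k. min (psum x k) (psum x (Suc k) - s)))"
      by (rule nn_integral_indicator) (simp add: sets_shadow)
    also have "shadow {..<m} (\<lambda>k. min (psum x k) (psum x (Suc k) - s)) = shadow {..<m} (psum (merge_at i s x))"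
      by (rule shadow_cong) (simp_all add: psum_merge_at[OF x i(2,3,1)] del: psum_Suc)
    finally show ?thesis using F[OF decr_merge_at[OF x i(2,3,1)]] by simp
  qed
  have \<phi>_out: "\<phi> s = 0" if "s \<notin> {x (Suc m)..x 0}" for s
  proof -
    have "\<phi> s = (\<integral>\<^sup>+ z. 0 \<partial>?M {..<m})"
      unfolding \<phi>_def by (rule nn_integral_cong) (use that in \<open>simp add: slice\<close>)
    then show ?thesis by simp
  qed
  have \<phi>_g: "\<phi> s = ennreal (indicator {x (Suc m)..x 0} s * g s)" for s
  proof (cases "s \<in> {x (Suc m)..x 0}")
    case True
    then obtain i where "i \<le> m" "x (Suc i) \<le> s" "s \<le> x i"
      using decr_interval_cover[OF x, of s] by auto
    then have "\<phi> s = ennreal (F (merge_at i s x))" "0 \<le> F (merge_at i s x)" using \<phi>_eq by auto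
    then show ?thesis using True by (simp add: g_def)
  qed (simp add: \<phi>_out)
  have "(g has_integral G i x) {x (Suc i)..x i}" if i: "i \<le> m" for i
  proof (rule has_integral_eq[OF _ G[OF i]])
    show "x (Suc i) \<le> x i" using x i by (simp add: decr_def)
    show "F (merge_at i s x) = g s" if "s \<in> {x (Suc i)..x i}" for s
      using \<phi>_eq[OF i, of s] that by (simp add: g_def)
  qed
  then have int: "(g has_integral (\<Sum>i\<le>m. G i x)) {x (Suc m)..x 0}"
    by (rule has_integral_decr_intervals[OF x])
  have "emeasure (?M (insert m {..<m})) A = (\<integral>\<^sup>+ z. indicator A z \<partial>?M (insert m {..<m}))"
    by simp
  also have "\<dots> = (\<integral>\<^sup>+ s. \<phi> s \<partial>lborel)"
    unfolding \<phi>_def by (rule product_nn_integral_insert_rev) auto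
  also have "\<dots> = (\<integral>\<^sup>+ s. ennreal (indicator {x (Suc m)..x 0} s * g s) \<partial>lborel)"
    by (simp only: \<phi>_g)
  also have "\<dots> = ennreal (\<Sum>i\<le>m. G i x)"
  proof (rule nn_integral_has_integral_lborel)
    have "(\<lambda>s. if s \<in> {x (Suc m)..x 0} then g s else 0) = (\<lambda>s. indicator {x (Suc m)..x 0} s * g s)"
      by auto
    then show "((\<lambda>s. indicator {x (Suc m)..x 0} s * g s) has_integral (\<Sum>i\<le>m. G i x)) UNIV"
      using int has_integral_restrict_UNIV[of "{x (Suc m)..x 0}" g] by simp
    have "g \<in> borel_measurable borel" unfolding g_def using \<phi>_meas by measurable
    then show "(\<lambda>s. indicator {x (Suc m)..x 0} s * g s) \<in> borel_measurable borel" by measurable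
  qed (simp add: g_def)
  finally have "emeasure (?M (insert m {..<m})) A = ennreal (\<Sum>i\<le>m. G i x)" .
  moreover have "0 \<le> (\<Sum>i\<le>m. G i x)"
    by (rule has_integral_nonneg[OF int]) (simp add: g_def)
  ultimately show ?thesis by (simp add: A_def lessThan_Suc)
qed

text \<open>Slicing off one coordinate at a time produces the polynomial by induction on
  \<open>m\<close>. The clause on the vector \<open>(c, 0, ..., 0)\<close>, whose permutohedron is
  the standard simplex scaled by \<open>c\<close>, later fixes the scale; nonnegativity keeps
  \<open>ennreal\<close> from cutting off values.\<close>

lemma volume_shadow:
  "\<exists>F. hpoly (Suc m) m F \<and> (\<forall>x. decr m x \<longrightarrow> 0 \<le> F x \<and>
      emeasure (Pi\<^sub>M {..<m} (\<lambda>_. lborel)) (shadow {..<m} (psum x)) = ennreal (F x)) \<and>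
    (\<forall>c\<ge>0. F (\<lambda>i. if i = 0 then c else 0) = c ^ m / fact m)"
proof (induction m)
  case 0
  have "shadow {..<0} (psum x) = {\<lambda>_. undefined}" for x
    by (auto simp: shadow_def)
  moreover have "emeasure (Pi\<^sub>M {..<0} (\<lambda>_. lborel)) {\<lambda>_::nat. undefined :: real} = 1"
    by (simp add: PiM_empty)
  ultimately show ?case by (intro exI[of _ "\<lambda>_. 1"]) (auto intro: hpoly_const)
next
  case (Suc m)
  then obtain F where F: "hpoly (Suc m) m F"
      "\<And>x. decr m x \<Longrightarrow> 0 \<le> F x \<and>
        emeasure (Pi\<^sub>M {..<m} (\<lambda>_. lborel)) (shadow {..<m} (psum x)) = ennreal (F x)"
      "\<And>c. 0 \<le> c \<Longrightarrow> F (\<lambda>i. if i = 0 then c else 0) = c ^ m / fact m"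
    by blast
  have "\<exists>G. hpoly (Suc (Suc m)) (Suc m) G \<and> (\<forall>x. x (Suc i) \<le> x i \<longrightarrow>
      ((\<lambda>s. F (merge_at i s x)) has_integral G x) {x (Suc i)..x i})" if "i \<le> m" for i
    using hpoly_integral[OF F(1), of i] that by (metis le_imp_less_Suc)
  then obtain G where G: "\<And>i. i \<le> m \<Longrightarrow> hpoly (Suc (Suc m)) (Suc m) (G i)"
    "\<And>i x. i \<le> m \<Longrightarrow> x (Suc i) \<le> x i \<Longrightarrow>
      ((\<lambda>s. F (merge_at i s x)) has_integral G i x) {x (Suc i)..x i}"
    by metis
  define V where "V = (\<lambda>x. \<Sum>i\<le>m. G i x)"
  have "hpoly (Suc (Suc m)) (Suc m) V"
    unfolding V_def by (intro hpoly_sum) (auto intro: G)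
  moreover have "0 \<le> V x \<and> emeasure (Pi\<^sub>M {..<Suc m} (\<lambda>_. lborel)) (shadow {..<Suc m} (psum x))
      = ennreal (V x)" if "decr (Suc m) x" for x
    unfolding V_def by (rule volume_shadow_Suc[OF F(2) G(2) that])
  moreover have "V (\<lambda>i. if i = 0 then c else 0) = c ^ Suc m / fact (Suc m)" if c: "0 \<le> c" for c
  proof -
    define x :: "nat \<Rightarrow> real" where "x = (\<lambda>i. if i = 0 then c else 0)"
    \<comment> \<open>All intervals except the one for \<open>i = 0\<close> shrink to a
      point.\<close>
    have "G i x = 0" if "i \<in> {..m} - {0}" for i
      using G(2)[of i x] that has_integral_unique[OF _ has_integral_refl(2)] by (auto simp: x_def)
    then have "V x = G 0 x"
      unfolding V_def by (subst sum.remove[of _ 0]) auto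
    moreover have "((\<lambda>s. F (merge_at 0 s x)) has_integral G 0 x) {0..c}"
      using G(2)[of 0 x] c by (simp add: x_def)
    moreover have "((\<lambda>s. F (merge_at 0 s x)) has_integral c ^ Suc m / fact (Suc m)) {0..c}"
    proof -
      have "((\<lambda>s. (c - s) ^ m / fact m) has_integral
          - ((c - c) ^ Suc m / fact (Suc m)) - - ((c - 0) ^ Suc m / fact (Suc m))) {0..c}"
        using c
        by (intro fundamental_theorem_of_calculus)
          (auto simp flip: has_real_derivative_iff_has_vector_derivative simp del: power_Suc
            intro!: derivative_eq_intros)
      moreover have "F (merge_at 0 s x) = (c - s) ^ m / fact m" if "s \<in> {0..c}" for s
      proof -
        have "merge_at 0 s x = (\<lambda>i. if i = 0 then c - s else 0)"
          by (auto simp: merge_at_def x_def)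
        then show ?thesis using F(3)[of "c - s"] that by simp
      qed
      ultimately show ?thesis by (auto intro: has_integral_eq)
    qed
    ultimately show ?thesis using has_integral_unique unfolding x_def by metis
  qed
  ultimately show ?case by blast
qed

section \<open>Minkowski combinations of hypersimplices\<close>

text \<open>
  Peeling off a coordinate turns integral levels into fractional ones, so the induction needs
  real levels \<open>j t\<close>.
\<close>

lemma minkowski_hypersimplices:
  fixes l j :: "'b \<Rightarrow> real" and y :: "'a \<Rightarrow> real"
  assumes "finite I" "\<And>t. t \<in> T \<Longrightarrow> 0 \<le> l t" "\<And>t. t \<in> T \<Longrightarrow> 0 \<le> j t \<and> j t \<le> card I"
    and "\<And>S. S \<subseteq> I \<Longrightarrow> sum y S \<le> (\<Sum>t\<in>T. l t * min (card S) (j t))"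
    and "sum y I = (\<Sum>t\<in>T. l t * j t)"
  shows "\<exists>z. (\<forall>t\<in>T. (\<forall>i\<in>I. 0 \<le> z t i \<and> z t i \<le> 1) \<and> sum (z t) I = j t) \<and>
    (\<forall>i\<in>I. y i = (\<Sum>t\<in>T. l t * z t i))"
  using assms
proof (induction I arbitrary: j rule: finite_induct)
  case empty
  then show ?case by (intro exI[of _ "\<lambda>_ _. 0"]) (force intro: antisym)
next
  case (insert a I j)
  note l = insert.prems(1) and j = insert.prems(2) and sub = insert.prems(3) and tot = insert.prems(4)
  \<comment> \<open>The number \<open>clamp (j t - c)\<close> is the share of summand
    \<open>t\<close> in coordinate \<open>a\<close>. The total share decreases continuously in the
    threshold \<open>c\<close>, from at least \<open>y a\<close> at \<open>0\<close> to at most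
    \<open>y a\<close> at \<open>card I\<close>, so some \<open>c\<close> gives exactly
    \<open>y a\<close>.\<close>
  define clamp :: "real \<Rightarrow> real" where "clamp v = max 0 (min 1 v)" for v
  let ?f = "\<lambda>c. \<Sum>t\<in>T. l t * clamp (j t - c)"
  have "y a \<le> (\<Sum>t\<in>T. l t * min 1 (j t))" using sub[of "{a}"] by simp
  also have "\<dots> = ?f 0" using j by (intro sum.cong) (auto simp: clamp_def)
  finally have f0: "y a \<le> ?f 0" .
  have "?f (card I) = (\<Sum>t\<in>T. l t * j t) - (\<Sum>t\<in>T. l t * min (card I) (j t))"
    unfolding sum_subtractf[symmetric] right_diff_distrib[symmetric]
    using j insert.hyps by (intro sum.cong) (fastforce simp: clamp_def min_def max_def)+
  also have "\<dots> \<le> y a" using sub[of I] tot insert.hyps by (simp add: subset_insertI)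
  finally have fn: "?f (card I) \<le> y a" .
  have "continuous_on {0..real (card I)} ?f"
    unfolding clamp_def by (intro continuous_intros)
  then obtain c :: real where c: "0 \<le> c" "c \<le> card I" "?f c = y a"
    using IVT2'[of ?f "card I" "y a" 0] f0 fn by auto
  define p where "p t = clamp (j t - c)" for t
  define j' where "j' t = j t - p t" for t
  have ya: "y a = (\<Sum>t\<in>T. l t * p t)" using c by (simp add: p_def)
  have "\<exists>z. (\<forall>t\<in>T. (\<forall>i\<in>I. 0 \<le> z t i \<and> z t i \<le> 1) \<and> sum (z t) I = j' t) \<and>
    (\<forall>i\<in>I. y i = (\<Sum>t\<in>T. l t * z t i))"
  proof (rule insert.IH)
    show "0 \<le> j' t \<and> j' t \<le> card I" if "t \<in> T" for t
      using j[OF that] c insert.hyps by (auto simp: j'_def p_def clamp_def)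
    show "sum y I = (\<Sum>t\<in>T. l t * j' t)"
      using tot insert.hyps ya by (simp add: j'_def right_diff_distrib sum_subtractf)
    show "sum y S \<le> (\<Sum>t\<in>T. l t * min (card S) (j' t))" if S: "S \<subseteq> I" for S
    \<comment> \<open>Up to the threshold the inequality of \<open>S\<close> itself passes to the
      remaining levels, above it that of \<open>insert a S\<close>; both comparisons hold summand by
      summand.\<close>
    proof (cases "card S \<le> c")
      case True
      have "sum y S \<le> (\<Sum>t\<in>T. l t * min (card S) (j t))" using sub[of S] S by auto
      also have "\<dots> \<le> (\<Sum>t\<in>T. l t * min (card S) (j' t))"
        using True by (intro sum_mono mult_left_mono l) (auto simp: j'_def p_def clamp_def)
      finally show ?thesis .
    next
      case False
      have "finite S" "a \<notin> S" using S insert.hyps finite_subset by auto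
      then have "y a + sum y S \<le> (\<Sum>t\<in>T. l t * min (Suc (card S)) (j t))"
        using sub[of "insert a S"] S by auto
      then have "sum y S \<le> (\<Sum>t\<in>T. l t * (min (Suc (card S)) (j t) - p t))"
        unfolding ya right_diff_distrib sum_subtractf by simp
      also have "\<dots> \<le> (\<Sum>t\<in>T. l t * min (card S) (j' t))"
        using False by (intro sum_mono mult_left_mono l) (auto simp: j'_def p_def clamp_def)
      finally show ?thesis .
    qed
  qed (fact l)
  then obtain z where z: "\<And>t i. t \<in> T \<Longrightarrow> i \<in> I \<Longrightarrow> 0 \<le> z t i \<and> z t i \<le> 1"
      "\<And>t. t \<in> T \<Longrightarrow> sum (z t) I = j' t" "\<And>i. i \<in> I \<Longrightarrow> y i = (\<Sum>t\<in>T. l t * z t i)"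
    by blast
  let ?z = "\<lambda>t. (z t)(a := p t)"
  have "sum (?z t) I = sum (z t) I" for t using insert.hyps by (intro sum.cong) auto
  then have "sum (?z t) (insert a I) = j t" if "t \<in> T" for t
    using z(2)[OF that] insert.hyps by (simp add: j'_def)
  moreover have "0 \<le> p t \<and> p t \<le> 1" for t by (auto simp: p_def clamp_def)
  moreover have "y i = (\<Sum>t\<in>T. l t * ?z t i)" if "i \<in> insert a I" for i
    using that z(3) ya by (cases "i = a") auto
  ultimately show ?case
    using z(1) insert.hyps by (intro exI[of _ ?z]) (simp del: fun_upd_apply, simp)
qed

text \<open>For \<open>h = psum x\<close> with decreasing \<open>x\<close> this is the convex hull
  of the permutations of \<open>x\<close> (Rado).\<close>

definition perm :: "nat \<Rightarrow> (nat \<Rightarrow> real) \<Rightarrow> (nat \<Rightarrow> real) set" where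
  "perm n h = {y \<in> extensional {..<n}.
     (\<forall>S\<subseteq>{..<n}. sum y S \<le> h (card S)) \<and> sum y {..<n} = h n}"

text \<open>The inverse of forgetting coordinate \<open>m\<close> on the hyperplane of coordinate
  sum \<open>c\<close>.\<close>

definition lift :: "nat \<Rightarrow> real \<Rightarrow> (nat \<Rightarrow> real) \<Rightarrow> nat \<Rightarrow> real" where
  "lift m c z = z(m := c - sum z {..<m})"

lemma sum_lift:
  "S \<subseteq> {..<m} \<Longrightarrow> sum (lift m c z) S = sum z S" "sum (lift m c z) {..<Suc m} = c"
proof -
  have *: "sum (lift m c z) S = sum z S" if "S \<subseteq> {..<m}" for S
    using that by (intro sum.cong) (auto simp: lift_def)
  show "S \<subseteq> {..<m} \<Longrightarrow> sum (lift m c z) S = sum z S" by (rule *)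
  show "sum (lift m c z) {..<Suc m} = c" using *[of "{..<m}"] by (simp add: lift_def)
qed

text \<open>An upper bound for a set containing \<open>m\<close> is, by complementation within the
  fixed total, a lower bound for a set avoiding \<open>m\<close>.\<close>

lemma lift_mem_perm:
  assumes z: "z \<in> extensional {..<m}"
  shows "lift m (h (Suc m)) z \<in> perm (Suc m) h \<longleftrightarrow> z \<in> shadow {..<m} h"
proof -
  let ?y = "lift m (h (Suc m)) z"
  let ?C = "\<lambda>S. {..<Suc m} - S"
  have C: "card (?C S) = Suc m - card S" "sum ?y (?C S) = h (Suc m) - sum ?y S"
    "card S \<le> Suc m" if "S \<subseteq> {..<Suc m}" for S
    using that finite_subset[OF that] sum_lift(2)[of m "h (Suc m)" z] card_mono[OF _ that]
    by (auto simp: card_Diff_subset sum_diff)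
  show ?thesis
  proof
    assume L: "?y \<in> perm (Suc m) h"
    have "sum z S \<le> h (card S) \<and> h (Suc m) - h (Suc m - card S) \<le> sum z S" if S: "S \<subseteq> {..<m}" for S
    proof -
      have "S \<subseteq> {..<Suc m}" using S by auto
      then have "sum ?y S \<le> h (card S)" "sum ?y (?C S) \<le> h (card (?C S))"
        using L by (auto simp: perm_def)
      then show ?thesis using C[OF \<open>S \<subseteq> {..<Suc m}\<close>] sum_lift(1)[OF S] by simp
    qed
    then show "z \<in> shadow {..<m} h" using z by (simp add: shadow_def)
  next
    assume R: "z \<in> shadow {..<m} h"
    have "sum ?y S \<le> h (card S)" if S: "S \<subseteq> {..<Suc m}" for S
    proof (cases "m \<in> S")
      case True
      then have m: "?C S \<subseteq> {..<m}" using less_Suc_eq by auto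
      then have "h (Suc m) - h (Suc m - card (?C S)) \<le> sum z (?C S)"
        using R by (simp add: shadow_def)
      then show ?thesis using C[OF S] sum_lift(1)[OF m] by simp
    next
      case False
      then have "S \<subseteq> {..<m}" using S by (auto simp: less_Suc_eq)
      then show ?thesis using R sum_lift(1)[of S m] by (simp add: shadow_def)
    qed
    moreover have "?y \<in> extensional {..<Suc m}"
      using z by (auto simp: lift_def extensional_def)
    ultimately show "?y \<in> perm (Suc m) h" using sum_lift(2)[of m "h (Suc m)" z] by (simp add: perm_def)
  qed
qed

definition step_weights :: "nat \<Rightarrow> (nat \<Rightarrow> real) \<Rightarrow> (nat \<Rightarrow> nat) \<Rightarrow> nat \<Rightarrow> real" where
  "step_weights m l js i = (\<Sum>t<m. l t * of_bool (i < js t))"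

lemma psum_step_weights: "psum (step_weights m l js) k = (\<Sum>t<m. l t * min (real k) (real (js t)))"
proof -
  have "psum (step_weights m l js) k = (\<Sum>t<m. l t * (\<Sum>i<k. of_bool (i < js t)))"
    unfolding psum_def step_weights_def sum_distrib_left by (rule sum.swap)
  also have "(\<lambda>t. \<Sum>i<k. of_bool (i < js t)) = (\<lambda>t. min (real k) (real (js t)))"
    by (rule ext, induction k) auto
  finally show ?thesis by meson
qed

lemma decr_step_weights: "(\<And>t. t < m \<Longrightarrow> 0 \<le> l t) \<Longrightarrow> decr n (step_weights m l js)"
  unfolding decr_def step_weights_def by (intro allI impI sum_mono mult_left_mono) auto

text \<open>A point of the hypersimplex of level \<open>j\<close> has sum at most
  \<open>min (card S) j\<close> over \<open>S\<close>, and complements give the lower bounds;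
  conversely \<open>minkowski_hypersimplices\<close> splits a lifted point into summands. The
  integer translations change only the coordinate that is forgotten.\<close>

lemma lattice_volume_minkowski_comb:
  assumes l: "\<And>t. t < m \<Longrightarrow> 0 \<le> l t" and js: "\<And>t. t < m \<Longrightarrow> js t \<le> m"
  shows "lattice_volume m (minkowski_comb m l (\<lambda>t. hypersimplex0 m (js t))) =
    measure (Pi\<^sub>M {..<m} (\<lambda>_. lborel)) (shadow {..<m} (psum (step_weights m l js)))"
proof -
  let ?h = "psum (step_weights m l js)"
  have h: "?h k = (\<Sum>t<m. l t * min (real k) (real (js t)))" for k by (rule psum_step_weights)
  have "(\<lambda>x. restrict x {..<m}) ` minkowski_comb m l (\<lambda>t. hypersimplex0 m (js t)) = shadow {..<m} ?h"
  proof (intro equalityI subsetI)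
    fix z assume "z \<in> (\<lambda>x. restrict x {..<m}) ` minkowski_comb m l (\<lambda>t. hypersimplex0 m (js t))"
    then obtain w where w: "\<forall>t<m. w t \<in> hypersimplex0 m (js t)"
      and z: "z = restrict (\<lambda>i\<in>{..<Suc m}. \<Sum>t<m. l t * w t i) {..<m}"
      by (auto simp: minkowski_comb_def)
    from w have "\<forall>t<m. \<exists>x. x \<in> hypersimplex (js t) (Suc m) \<and> (\<forall>i<m. w t i = x i)"
      by (fastforce simp: hypersimplex0_def)
    then obtain x where x: "\<And>t. t < m \<Longrightarrow> x t \<in> hypersimplex (js t) (Suc m)"
        "\<And>t i. t < m \<Longrightarrow> i < m \<Longrightarrow> w t i = x t i"
      by metis
    have zi: "z i = (\<Sum>t<m. l t * x t i)" if "i < m" for i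
      using that x(2) by (auto simp: z intro!: sum.cong)
    have x_le: "sum (x t) S \<le> min (real (card S)) (real (js t))" if "t < m" "S \<subseteq> {..<Suc m}" for t S
    proof -
      have S: "finite S" using that(2) finite_subset by blast
      have b: "0 \<le> x t i \<and> x t i \<le> 1" if "i < Suc m" for i
        using x(1)[OF \<open>t < m\<close>] that by (fastforce simp: hypersimplex_def PiE_def Pi_def)
      have "sum (x t) S \<le> (\<Sum>i\<in>S. 1)" using b that(2) by (intro sum_mono) auto
      moreover have "sum (x t) S \<le> sum (x t) {..<Suc m}"
        using b that(2) by (intro sum_mono2) auto
      moreover have "sum (x t) {..<Suc m} = js t" using x(1)[OF that(1)] by (simp add: hypersimplex_def)
      ultimately show ?thesis by simp
    qed
    have "sum z S \<le> ?h (card S) \<and> ?h (Suc m) - ?h (Suc m - card S) \<le> sum z S" if S: "S \<subseteq> {..<m}" for S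
    proof -
      have "sum z S = (\<Sum>i\<in>S. \<Sum>t<m. l t * x t i)"
        using S zi by (intro sum.cong) auto
      also have "\<dots> = (\<Sum>t<m. l t * sum (x t) S)"
        by (subst sum.swap) (simp add: sum_distrib_left)
      finally have zS: "sum z S = (\<Sum>t<m. l t * sum (x t) S)" .
      have S': "S \<subseteq> {..<Suc m}" "finite S" using S finite_subset by fastforce+
      have "sum z S \<le> ?h (card S)"
        unfolding zS h using S' by (intro sum_mono mult_left_mono l x_le) auto
      moreover have "?h (Suc m) - ?h (Suc m - card S) \<le> sum z S"
        unfolding zS h sum_subtractf[symmetric] right_diff_distrib[symmetric]
      proof (intro sum_mono mult_left_mono l)
        fix t assume t: "t \<in> {..<m}"
        have "sum (x t) ({..<Suc m} - S) \<le> min (real (Suc m - card S)) (real (js t))"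
          using x_le[of t "{..<Suc m} - S"] t S' by (auto simp: card_Diff_subset)
        moreover have "sum (x t) ({..<Suc m} - S) = js t - sum (x t) S"
          using x(1)[of t] t S' by (subst sum_diff) (auto simp: hypersimplex_def)
        ultimately show "min (real (Suc m)) (real (js t)) - min (real (Suc m - card S)) (real (js t)) \<le> sum (x t) S"
          by linarith
      qed auto
      ultimately show ?thesis ..
    qed
    moreover have "z \<in> extensional {..<m}" by (auto simp: z extensional_def)
    ultimately show "z \<in> shadow {..<m} ?h" by (simp add: shadow_def)
  next
    fix z assume z: "z \<in> shadow {..<m} ?h"
    define y where "y = lift m (?h (Suc m)) z"
    have y: "y \<in> perm (Suc m) ?h"
      using z lift_mem_perm[of z m ?h] by (simp add: y_def shadow_def)
    then have tot: "sum y {..<Suc m} = ?h (Suc m)" by (simp add: perm_def)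
    have "\<exists>x. (\<forall>t\<in>{..<m}. (\<forall>i\<in>{..<Suc m}. 0 \<le> x t i \<and> x t i \<le> 1) \<and> sum (x t) {..<Suc m} = real (js t)) \<and>
      (\<forall>i\<in>{..<Suc m}. y i = (\<Sum>t<m. l t * x t i))"
    proof (rule minkowski_hypersimplices)
      show "sum y {..<Suc m} = (\<Sum>t<m. l t * real (js t))"
        unfolding tot h using js by (intro sum.cong refl) (fastforce dest: le_SucI simp: min_absorb2 of_nat_le_iff simp del: of_nat_Suc)
      show "sum y S \<le> (\<Sum>t<m. l t * min (card S) (real (js t)))" if "S \<subseteq> {..<Suc m}" for S
        using y that h by (auto simp: perm_def)
      show "0 \<le> real (js t) \<and> real (js t) \<le> real (card {..<Suc m})" if "t \<in> {..<m}" for t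
        using js[of t] that by simp
    qed (use l in auto)
    then obtain x where x: "\<And>t i. t < m \<Longrightarrow> i < Suc m \<Longrightarrow> 0 \<le> x t i \<and> x t i \<le> 1"
        "\<And>t. t < m \<Longrightarrow> sum (x t) {..<Suc m} = real (js t)"
        "\<And>i. i < Suc m \<Longrightarrow> y i = (\<Sum>t<m. l t * x t i)"
      by auto
    define x' where "x' t = restrict (x t) {..<Suc m}" for t
    define w where "w t = (\<lambda>i\<in>{..<Suc m}. x' t i - (if i = m then real (js t) else 0))" for t
    have "sum (x' t) {..<Suc m} = js t" if "t < m" for t
      using x(2)[OF that] by (simp add: x'_def)
    then have "x' t \<in> hypersimplex (js t) (Suc m)" if "t < m" for t
      using x(1)[OF that] that by (auto simp: hypersimplex_def x'_def)
    then have "\<forall>t<m. w t \<in> hypersimplex0 m (js t)"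
      by (auto simp: hypersimplex0_def w_def)
    then have "(\<lambda>i\<in>{..<Suc m}. \<Sum>t<m. l t * w t i) \<in> minkowski_comb m l (\<lambda>t. hypersimplex0 m (js t))"
      by (auto simp: minkowski_comb_def)
    moreover have "z = restrict (\<lambda>i\<in>{..<Suc m}. \<Sum>t<m. l t * w t i) {..<m}"
    proof
      fix i
      show "z i = restrict (\<lambda>i\<in>{..<Suc m}. \<Sum>t<m. l t * w t i) {..<m} i"
      proof (cases "i < m")
        case True
        then have "z i = y i" by (simp add: y_def lift_def)
        then show ?thesis using True x(3)[of i] by (simp add: w_def x'_def)
      next
        case False
        then show ?thesis using z by (simp add: shadow_def extensional_def)
      qed
    qed
    ultimately show "z \<in> (\<lambda>x. restrict x {..<m}) ` minkowski_comb m l (\<lambda>t. hypersimplex0 m (js t))"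
      by blast
  qed
  then show ?thesis by (simp add: lattice_volume_def)
qed

section \<open>Volume change along simple roots\<close>

lemma distr_PiM_lborel_translate:
  fixes v :: "'i \<Rightarrow> real"
  assumes "finite I"
  defines "M \<equiv> Pi\<^sub>M I (\<lambda>_. lborel)"
  shows "distr M M (\<lambda>z. \<lambda>i\<in>I. z i + v i) = M"
proof -
  interpret product_sigma_finite "\<lambda>_::'i. lborel :: real measure" by standard
  have T[measurable]: "(\<lambda>z. \<lambda>i\<in>I. z i + v i) \<in> M \<rightarrow>\<^sub>M M"
    unfolding M_def by measurable
  show ?thesis
    unfolding M_def
  proof (rule PiM_eqI[OF assms(1)], goal_cases)
    case 1 show ?case by simp
  next
    case (2 A)
    have "(\<lambda>z. \<lambda>i\<in>I. z i + v i) -` Pi\<^sub>E I A \<inter> space M = Pi\<^sub>E I (\<lambda>i. (\<lambda>x. v i + x) -` A i)"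
      by (auto simp: M_def space_PiM PiE_def Pi_def add.commute)
    moreover have "emeasure lborel ((\<lambda>x. v i + x) -` A i) = emeasure lborel (A i)" if "i \<in> I" for i
    proof -
      have "A i \<in> sets borel" using 2[OF that] by simp
      then have "emeasure (distr lborel borel ((+) (v i))) (A i) = emeasure lborel ((+) (v i) -` A i)"
        by (subst emeasure_distr) auto
      then show ?thesis by (simp add: lborel_distr_plus)
    qed
    moreover have "(\<lambda>x. v i + x) -` A i \<in> sets lborel" if "i \<in> I" for i
    proof -
      have "(\<lambda>x. v i + x) -` A i \<inter> space lborel \<in> sets lborel"
        by (rule measurable_sets[OF _ 2[OF that]]) simp
      then show ?thesis by simp
    qed
    moreover have "Pi\<^sub>E I A \<in> sets M" unfolding M_def using 2 assms(1) by (intro sets_PiM_I_finite) auto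
    ultimately show ?case
      using emeasure_distr[OF T, of "Pi\<^sub>E I A"] assms(1) unfolding M_def
      by (simp add: emeasure_PiM)
  qed
qed

lemma measure_PiM_lborel_translate:
  fixes v :: "'i \<Rightarrow> real"
  assumes "finite I" "A \<in> sets (Pi\<^sub>M I (\<lambda>_. lborel))"
  shows "measure (Pi\<^sub>M I (\<lambda>_. lborel)) ((\<lambda>z. \<lambda>i\<in>I. z i + v i) ` A) = measure (Pi\<^sub>M I (\<lambda>_. lborel)) A"
proof -
  let ?M = "Pi\<^sub>M I (\<lambda>_::'i. lborel :: real measure)"
  let ?T = "\<lambda>v z. \<lambda>i\<in>I. z i + (v i :: real)"
  have A: "A \<subseteq> extensional I"
    using sets.sets_into_space[OF assms(2)] by (auto simp: space_PiM PiE_def)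
  have meas: "?T v \<in> ?M \<rightarrow>\<^sub>M ?M" for v by measurable
  have inv: "?T v (?T (\<lambda>i. - v i) z) = z" "?T (\<lambda>i. - v i) (?T v z) = z" if "z \<in> extensional I" for z
    using that by (auto simp: extensional_def)
  have "?T v ` A = ?T (\<lambda>i. - v i) -` A \<inter> space ?M"
  proof (intro equalityI subsetI)
    fix z assume "z \<in> ?T v ` A"
    then show "z \<in> ?T (\<lambda>i. - v i) -` A \<inter> space ?M"
      using A inv(2) by (auto simp: space_PiM PiE_def simp del: restrict_apply)
  next
    fix z assume z: "z \<in> ?T (\<lambda>i. - v i) -` A \<inter> space ?M"
    then have "z = ?T v (?T (\<lambda>i. - v i) z)" using inv(1) by (simp add: space_PiM PiE_def)
    then show "z \<in> ?T v ` A" using z by blast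
  qed
  then have "measure ?M (?T v ` A) = measure (distr ?M ?M (?T (\<lambda>i. - v i))) A"
    using measure_distr[OF meas assms(2), of "\<lambda>i. - v i"] by (simp only:)
  then show ?thesis by (simp only: distr_PiM_lborel_translate[OF assms(1)])
qed

section \<open>Caps beyond the relaxed facets\<close>

text \<open>Partial sums of a decreasing vector are concave. The lemma is applied to the
  cardinalities \<open>a\<close> of an intersection and \<open>b\<close> of a union of sets of sizes
  \<open>k\<close> and \<open>r\<close>.\<close>

lemma psum_concave:
  assumes "decr m x" "a \<le> k" "a \<le> r" "a + b = k + r" "b \<le> Suc m"
  shows "psum x a + psum x b \<le> psum x k + psum x r"
proof -
  have *: "psum x (r + d) - psum x r \<le> psum x (a + d) - psum x a" if "r + d \<le> Suc m" for d
    using that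
  proof (induction d)
    case (Suc d)
    have "x (r + d) \<le> x (a + d)" using decr_le[OF assms(1)] assms(3) Suc.prems by simp
    then show ?case using Suc by simp
  qed simp
  have "r + (k - a) = b" "a + (k - a) = k" using assms by auto
  then show ?thesis using *[of "k - a"] assms(5) by simp
qed

definition bump :: "nat \<Rightarrow> real \<Rightarrow> (nat \<Rightarrow> real) \<Rightarrow> nat \<Rightarrow> real" where
  "bump k s h = h(k := h k + s)"

text \<open>The part of the bumped body beyond the old facet belonging to \<open>S\<close>, where \<open>card S = k\<close>.\<close>

definition cap :: "nat \<Rightarrow> nat \<Rightarrow> real \<Rightarrow> (nat \<Rightarrow> real) \<Rightarrow> nat set \<Rightarrow> (nat \<Rightarrow> real) set" where
  "cap m k s h S = {z \<in> shadow {..<m} (bump k s h). h k < sum (lift m (h (Suc m)) z) S}"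

lemma sets_cap:
  assumes "S \<subseteq> {..<Suc m}"
  shows "cap m k s h S \<in> sets (Pi\<^sub>M {..<m} (\<lambda>_. lborel))"
proof -
  let ?M = "Pi\<^sub>M {..<m} (\<lambda>_. lborel :: real measure)"
  have comp: "(\<lambda>z. z i) \<in> borel_measurable ?M" if "i < m" for i
    using measurable_component_singleton[of i "{..<m}" "\<lambda>_. lborel"] that by simp
  have "(\<lambda>z. lift m c z i) \<in> borel_measurable ?M" if "i < Suc m" for i c
    unfolding lift_def using that comp
    by (cases "i = m") (auto intro!: borel_measurable_diff borel_measurable_sum)
  then have [measurable]: "(\<lambda>z. sum (lift m (h (Suc m)) z) S) \<in> borel_measurable ?M"
    using assms by (intro borel_measurable_sum) auto
  have "cap m k s h S = shadow {..<m} (bump k s h) \<inter>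
      {z \<in> space ?M. h k < sum (lift m (h (Suc m)) z) S}"
    by (auto simp: cap_def shadow_def space_PiM PiE_def)
  then show ?thesis using sets_shadow[of "{..<m}" "bump k s h"] by simp
qed

lemma sum_modular:
  fixes y :: "nat \<Rightarrow> real"
  assumes "finite R" "finite S"
  shows "sum y (R \<inter> S) + sum y (R \<union> S) = sum y R + sum y S"
  using sum.union_inter[OF assms, of y] by simp

lemma card_inter_less:
  assumes "finite R" "finite S" "\<not> R \<subseteq> S" "\<not> S \<subseteq> R"
  shows "card (R \<inter> S) < card R" "card (R \<inter> S) < card S" "card R < card (R \<union> S)" "card S < card (R \<union> S)"
  using assms by (auto intro!: psubset_card_mono)

text \<open>A point beyond the old bound on two different \<open>k\<close>-sets would, by modularity
  of sums and concavity of \<open>psum\<close>, violate the bound of their intersection or union;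
  these have sizes other than \<open>k\<close>, so their bounds are not relaxed.\<close>

lemma caps_disjoint:
  assumes x: "decr m x" and k: "k \<le> m"
    and S: "S \<subseteq> {..<Suc m}" "card S = k" and R: "R \<subseteq> {..<Suc m}" "card R = k" and "S \<noteq> R"
  shows "cap m k s (psum x) S \<inter> cap m k s (psum x) R = {}"
proof (rule ccontr)
  let ?h = "psum x"
  assume "\<not> ?thesis"
  then obtain z where z: "z \<in> cap m k s ?h S" "z \<in> cap m k s ?h R" by blast
  define y where "y = lift m (?h (Suc m)) z"
  have "z \<in> shadow {..<m} (bump k s ?h)" using z by (simp add: cap_def)
  then have "lift m (bump k s ?h (Suc m)) z \<in> perm (Suc m) (bump k s ?h)"
    using lift_mem_perm[of z m "bump k s ?h"] by (simp add: shadow_def)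
  \<comment> \<open>By \<open>k <= m\<close>, bumping leaves the total \<open>h (Suc m)\<close>
    unchanged.\<close>
  then have y: "y \<in> perm (Suc m) (bump k s ?h)" using k by (simp add: bump_def y_def del: psum_Suc)
  have fin: "finite S" "finite R" using S R finite_subset by blast+
  have ns: "\<not> S \<subseteq> R" "\<not> R \<subseteq> S"
    using \<open>S \<noteq> R\<close> S R fin card_subset_eq by metis+
  note c = card_inter_less[OF fin ns]
  have "S \<inter> R \<subseteq> {..<Suc m}" "S \<union> R \<subseteq> {..<Suc m}" using S R by auto
  then have "sum y (S \<inter> R) \<le> bump k s ?h (card (S \<inter> R))" "sum y (S \<union> R) \<le> bump k s ?h (card (S \<union> R))"
    using y by (simp_all add: perm_def)
  then have "sum y (S \<inter> R) \<le> ?h (card (S \<inter> R))" "sum y (S \<union> R) \<le> ?h (card (S \<union> R))"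
    using c S R by (auto simp: bump_def)
  moreover have "?h (card (S \<inter> R)) + ?h (card (S \<union> R)) \<le> ?h k + ?h k"
    using c S R card_Un_Int[OF fin] card_mono[of "{..<Suc m}" "S \<union> R"]
    by (intro psum_concave[OF x]) auto
  moreover have "?h k < sum y S" "?h k < sum y R" using z by (auto simp: cap_def y_def)
  ultimately show False using sum_modular[OF fin, of y] by linarith
qed

lemma shadow_bump:
  assumes x: "decr m x" and k: "k \<le> m" and s: "0 \<le> s"
  shows "shadow {..<m} (bump k s (psum x)) =
    shadow {..<m} (psum x) \<union> (\<Union>S\<in>{S. S \<subseteq> {..<Suc m} \<and> card S = k}. cap m k s (psum x) S)"
    (is "?L = ?R")
proof -
  let ?h = "psum x"
  have "z \<in> ?L \<longleftrightarrow> z \<in> ?R" for z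
  proof (cases "z \<in> extensional {..<m}")
    case True
    define y where "y = lift m (?h (Suc m)) z"
    have L: "z \<in> ?L \<longleftrightarrow> y \<in> perm (Suc m) (bump k s ?h)"
      using lift_mem_perm[OF True, of "bump k s ?h"] k by (simp add: bump_def y_def del: psum_Suc)
    have R: "z \<in> shadow {..<m} ?h \<longleftrightarrow> y \<in> perm (Suc m) ?h"
      using lift_mem_perm[OF True, of ?h] by (simp add: y_def del: psum_Suc)
    have "y \<in> perm (Suc m) (bump k s ?h)" if y: "y \<in> perm (Suc m) ?h"
    proof -
      have "sum y S \<le> bump k s ?h (card S)" if "S \<subseteq> {..<Suc m}" for S
      proof -
        have "sum y S \<le> ?h (card S)" using y that by (simp add: perm_def)
        then show ?thesis using s by (auto simp: bump_def)
      qed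
      then show ?thesis using y k by (simp add: perm_def bump_def del: psum_Suc)
    qed
    moreover have "y \<in> perm (Suc m) ?h"
      if y: "y \<in> perm (Suc m) (bump k s ?h)"
        and no: "\<And>S. S \<subseteq> {..<Suc m} \<Longrightarrow> card S = k \<Longrightarrow> \<not> ?h k < sum y S"
    proof -
      have "sum y S \<le> ?h (card S)" if S: "S \<subseteq> {..<Suc m}" for S
      proof (cases "card S = k")
        case True
        then show ?thesis using no[OF S] by simp
      next
        case False
        have "sum y S \<le> bump k s ?h (card S)" using y S by (simp add: perm_def)
        then show ?thesis using False by (simp add: bump_def)
      qed
      then show ?thesis using y k by (simp add: perm_def bump_def del: psum_Suc)
    qed
    ultimately show ?thesis
      unfolding Un_iff UN_iff L R cap_def mem_Collect_eq y_def[symmetric] by blast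
  qed (auto simp: shadow_def cap_def)
  then show ?thesis by blast
qed

text \<open>The caps are disjoint from the old body and from each other, so volumes add up.
  Finiteness is assumed because \<open>measure\<close> sends infinite values to 0.\<close>

lemma measure_shadow_bump:
  assumes x: "decr m x" and k: "k \<le> m" and s: "0 \<le> s"
    and fin: "emeasure (Pi\<^sub>M {..<m} (\<lambda>_. lborel)) (shadow {..<m} (bump k s (psum x))) \<noteq> \<infinity>"
  shows "measure (Pi\<^sub>M {..<m} (\<lambda>_. lborel)) (shadow {..<m} (bump k s (psum x))) =
    measure (Pi\<^sub>M {..<m} (\<lambda>_. lborel)) (shadow {..<m} (psum x)) +
    (\<Sum>S | S \<subseteq> {..<Suc m} \<and> card S = k. measure (Pi\<^sub>M {..<m} (\<lambda>_. lborel)) (cap m k s (psum x) S))"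
proof -
  let ?M = "Pi\<^sub>M {..<m} (\<lambda>_. lborel :: real measure)"
  let ?cap = "cap m k s (psum x)" and ?I = "{S. S \<subseteq> {..<Suc m} \<and> card S = k}"
  let ?U = "\<Union>S\<in>?I. ?cap S"
  have I: "finite ?I" by simp
  have eq: "shadow {..<m} (bump k s (psum x)) = shadow {..<m} (psum x) \<union> ?U"
    by (rule shadow_bump[OF x k s])
  have sets: "shadow {..<m} (psum x) \<in> sets ?M" "\<And>S. S \<in> ?I \<Longrightarrow> ?cap S \<in> sets ?M"
    "shadow {..<m} (bump k s (psum x)) \<in> sets ?M"
    by (simp_all add: sets_shadow sets_cap)
  then have U: "?U \<in> sets ?M" using I by blast
  have small: "emeasure ?M A \<noteq> \<infinity>" if "A \<subseteq> shadow {..<m} (bump k s (psum x))" for A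
    using emeasure_mono[OF that sets(3)] fin by (auto simp: top_unique)
  have "measure ?M (shadow {..<m} (bump k s (psum x))) = measure ?M (shadow {..<m} (psum x)) + measure ?M ?U"
    unfolding eq
  proof (rule measure_Union)
    show "shadow {..<m} (psum x) \<inter> ?U = {}"
    proof -
      have "z \<notin> ?cap S" if z: "z \<in> shadow {..<m} (psum x)" and S: "S \<in> ?I" for z S
      proof -
        have "lift m (psum x (Suc m)) z \<in> perm (Suc m) (psum x)"
          using z lift_mem_perm[of z m "psum x"] by (simp add: shadow_def del: psum_Suc)
        then have "sum (lift m (psum x (Suc m)) z) S \<le> psum x k"
          using S by (auto simp: perm_def)
        then show ?thesis by (simp add: cap_def)
      qed
      then show ?thesis by blast
    qed
    show "emeasure ?M (shadow {..<m} (psum x)) \<noteq> \<infinity>" "emeasure ?M ?U \<noteq> \<infinity>"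
      by (rule small, use eq in blast)+
  qed (use sets U in auto)
  also have "measure ?M ?U = (\<Sum>S\<in>?I. measure ?M (?cap S))"
  proof (rule measure_finite_Union[OF I])
    show "disjoint_family_on ?cap ?I"
      unfolding disjoint_family_on_def using caps_disjoint[OF x k] by simp
    show "emeasure ?M (?cap S) \<noteq> \<infinity>" for S
      by (rule small) (auto simp: cap_def)
  qed (use sets in auto)
  finally show ?thesis .
qed

lemma sum_translate:
  fixes y :: "nat \<Rightarrow> real"
  assumes "finite R"
  shows "(\<Sum>i\<in>R. y i + t * of_bool (i \<in> S)) = sum y R + t * real (card (R \<inter> S))"
  using assms by (simp add: sum.distrib sum_distrib_left[symmetric])

text \<open>Translation by \<open>t\<close> on \<open>S\<close> raises the sum over \<open>R\<close>
  by \<open>t * card (R \<inter> S)\<close>, at most the rise \<open>t * min (card R) k\<close> of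
  its bound, with equality if \<open>R\<close> and \<open>S\<close> are comparable. For incomparable
  \<open>R\<close> the old bound is recovered from those of \<open>R \<inter> S\<close> and
  \<open>R \<union> S\<close>, because the sum over \<open>S\<close> exceeds its unrelaxed
  bound.\<close>

lemma perm_cap_translate:
  fixes y :: "nat \<Rightarrow> real"
  assumes x: "decr m x" and k: "k \<le> m" and t: "0 \<le> t" and s: "0 \<le> s"
    and S: "S \<subseteq> {..<Suc m}" "card S = k" and y: "y \<in> extensional {..<Suc m}"
    and h': "\<And>j. h' j = psum x j + t * real (min j k)"
  defines "Y \<equiv> \<lambda>i\<in>{..<Suc m}. y i + t * of_bool (i \<in> S)"
  shows "Y \<in> perm (Suc m) (bump k s h') \<and> h' k < sum Y S \<longleftrightarrow>
    y \<in> perm (Suc m) (bump k s (psum x)) \<and> psum x k < sum y S"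
proof -
  let ?h = "psum x"
  have sumY: "sum Y R = sum y R + t * real (card (R \<inter> S))" if "R \<subseteq> {..<Suc m}" for R
  proof -
    have "sum Y R = (\<Sum>i\<in>R. y i + t * of_bool (i \<in> S))"
      unfolding Y_def using that by (intro sum.cong) auto
    then show ?thesis using sum_translate[of R y t S] finite_subset[OF that] by simp
  qed
  have fS: "finite S" using S finite_subset by blast
  have inter_le: "card (R \<inter> S) \<le> min (card R) k" if "R \<subseteq> {..<Suc m}" for R
    using that S fS finite_subset[OF that] by (auto intro: card_mono)
  have S_eq: "h' k < sum Y S \<longleftrightarrow> ?h k < sum y S"
    using sumY[OF S(1)] S h' by simp
  have "S \<inter> {..<Suc m} = S" using S by auto
  then have tot: "sum Y {..<Suc m} = bump k s h' (Suc m) \<longleftrightarrow> sum y {..<Suc m} = bump k s ?h (Suc m)"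
    using sumY[of "{..<Suc m}"] S k h'[of "Suc m"]
    by (simp add: bump_def Int_commute del: psum_Suc sum.lessThan_Suc)
  have "sum Y R \<le> bump k s h' (card R)"
    if "\<And>R. R \<subseteq> {..<Suc m} \<Longrightarrow> sum y R \<le> bump k s ?h (card R)" and R: "R \<subseteq> {..<Suc m}" for R
  proof -
    have "t * real (card (R \<inter> S)) \<le> t * real (min (card R) k)"
      using inter_le[OF R] t by (intro mult_left_mono) auto
    then show ?thesis using that(1)[OF R] sumY[OF R] h'[of "card R"] h'[of k] by (auto simp: bump_def)
  qed
  moreover have "sum y R \<le> bump k s ?h (card R)"
    if le: "\<And>R. R \<subseteq> {..<Suc m} \<Longrightarrow> sum Y R \<le> bump k s h' (card R)"
      and hS: "h' k < sum Y S" and R: "R \<subseteq> {..<Suc m}" for R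
  proof -
    have fR: "finite R" using R finite_subset by blast
    show ?thesis
    proof (cases "R \<subseteq> S \<or> S \<subseteq> R")
      case True
      then have "card (R \<inter> S) = min (card R) k"
      proof
        assume "R \<subseteq> S"
        then show ?thesis using card_mono[OF fS \<open>R \<subseteq> S\<close>] S by (simp add: Int_absorb2)
      next
        assume "S \<subseteq> R"
        then show ?thesis using card_mono[OF fR \<open>S \<subseteq> R\<close>] S by (simp add: Int_absorb1)
      qed
      then show ?thesis using le[OF R] sumY[OF R] h'[of "card R"] h'[of k] by (auto simp: bump_def)
    next
      case False
      then have c: "card (R \<inter> S) < card R" "card (R \<inter> S) < k" "card R < card (R \<union> S)" "k < card (R \<union> S)"
        using card_inter_less[OF fR fS] S by auto
      have "R \<inter> S \<subseteq> {..<Suc m}" "R \<union> S \<subseteq> {..<Suc m}" using R S by auto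
      then have "sum Y (R \<inter> S) \<le> bump k s h' (card (R \<inter> S))" "sum Y (R \<union> S) \<le> bump k s h' (card (R \<union> S))"
        using le by blast+
      then have "sum Y (R \<inter> S) \<le> ?h (card (R \<inter> S)) + t * real (card (R \<inter> S))"
        "sum Y (R \<union> S) \<le> ?h (card (R \<union> S)) + t * real k"
        using c h' by (simp_all add: bump_def min_def)
      moreover have "?h (card (R \<inter> S)) + ?h (card (R \<union> S)) \<le> ?h k + ?h (card R)"
        using c S R card_Un_Int[OF fR fS] card_mono[of "{..<Suc m}" "R \<union> S"]
        by (intro psum_concave[OF x]) auto
      moreover have "?h k + t * real k < sum Y S" using hS h'[of k] by simp
      ultimately have "sum y R < ?h (card R)"
        using sum_modular[OF fR fS, of Y] sumY[OF R] by linarith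
      then show ?thesis using s by (auto simp: bump_def)
    qed
  qed
  ultimately have "(\<forall>R\<subseteq>{..<Suc m}. sum Y R \<le> bump k s h' (card R)) \<and> h' k < sum Y S \<longleftrightarrow>
      (\<forall>R\<subseteq>{..<Suc m}. sum y R \<le> bump k s ?h (card R)) \<and> ?h k < sum y S"
    using S_eq by blast
  moreover have "Y \<in> extensional {..<Suc m}" by (simp add: Y_def)
  ultimately show ?thesis
    unfolding perm_def mem_Collect_eq tot using y by blast
qed

lemma lift_translate:
  assumes S: "S \<subseteq> {..<Suc m}" "card S = k" and z: "z \<in> extensional {..<m}"
  shows "lift m (c + t * real k) (\<lambda>i\<in>{..<m}. z i + t * of_bool (i \<in> S)) =
    (\<lambda>i\<in>{..<Suc m}. lift m c z i + t * of_bool (i \<in> S))"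
proof
  fix i
  have "sum (\<lambda>i\<in>{..<m}. z i + t * of_bool (i \<in> S)) {..<m} = sum z {..<m} + t * real (card ({..<m} \<inter> S))"
    using sum_translate[of "{..<m}" z t S] by simp
  moreover have "real k = real (card ({..<m} \<inter> S)) + of_bool (m \<in> S)"
  proof -
    have "S = ({..<m} \<inter> S) \<union> (if m \<in> S then {m} else {})" using S by (auto simp: less_Suc_eq)
    then have "card S = card (({..<m} \<inter> S) \<union> (if m \<in> S then {m} else {}))" by simp
    also have "\<dots> = card ({..<m} \<inter> S) + of_bool (m \<in> S)" by (subst card_Un_disjoint) auto
    finally show ?thesis using S by simp
  qed
  ultimately show "lift m (c + t * real k) (\<lambda>i\<in>{..<m}. z i + t * of_bool (i \<in> S)) i =
    (\<lambda>i\<in>{..<Suc m}. lift m c z i + t * of_bool (i \<in> S)) i"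
    using z by (auto simp: lift_def extensional_def algebra_simps)
qed

lemma measure_cap_translate:
  assumes x: "decr m x" and k: "k \<le> m" and t: "0 \<le> t" and s: "0 \<le> s"
    and S: "S \<subseteq> {..<Suc m}" "card S = k"
    and h': "\<And>j. h' j = psum x j + t * real (min j k)"
  shows "measure (Pi\<^sub>M {..<m} (\<lambda>_. lborel)) (cap m k s h' S) =
    measure (Pi\<^sub>M {..<m} (\<lambda>_. lborel)) (cap m k s (psum x) S)"
proof -
  let ?T = "\<lambda>t z. \<lambda>i\<in>{..<m}. z i + t * of_bool (i \<in> S) :: real"
  let ?h = "psum x"
  have cap_iff: "z \<in> cap m k s h S \<longleftrightarrow> lift m (h (Suc m)) z \<in> perm (Suc m) (bump k s h) \<and>
      h k < sum (lift m (h (Suc m)) z) S" if "z \<in> extensional {..<m}" for z h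
    using lift_mem_perm[OF that, of "bump k s h"] k by (simp add: cap_def bump_def del: fun_upd_apply) (simp add: bump_def)
  have iff: "?T t z \<in> cap m k s h' S \<longleftrightarrow> z \<in> cap m k s ?h S" if z: "z \<in> extensional {..<m}" for z
  proof -
    have "lift m (h' (Suc m)) (?T t z) = (\<lambda>i\<in>{..<Suc m}. lift m (?h (Suc m)) z i + t * of_bool (i \<in> S))"
      using lift_translate[OF S z, of "?h (Suc m)" t] h'[of "Suc m"] k by (simp del: psum_Suc)
    moreover have "lift m (?h (Suc m)) z \<in> extensional {..<Suc m}"
      using z by (auto simp: lift_def extensional_def)
    ultimately show ?thesis
      using perm_cap_translate[OF x k t s S _ h', of "lift m (?h (Suc m)) z"] z
      by (simp add: cap_iff del: psum_Suc)
  qed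
  have "cap m k s h' S = ?T t ` cap m k s ?h S"
  proof (intro equalityI subsetI)
    fix z assume z: "z \<in> cap m k s h' S"
    then have ext: "z \<in> extensional {..<m}" by (simp add: cap_def shadow_def)
    then have "z = ?T t (?T (- t) z)" by (auto simp: extensional_def)
    moreover from this have "?T (- t) z \<in> cap m k s ?h S" using iff[of "?T (- t) z"] z by simp
    ultimately show "z \<in> ?T t ` cap m k s ?h S" by blast
  next
    fix z assume "z \<in> ?T t ` cap m k s ?h S"
    then obtain w where w: "z = ?T t w" "w \<in> cap m k s ?h S" by blast
    then have "w \<in> extensional {..<m}" by (simp add: cap_def shadow_def)
    then show "z \<in> cap m k s h' S" using iff[of w] w by simp
  qed
  then show ?thesis
    using measure_PiM_lborel_translate[of "{..<m}" "cap m k s ?h S" "\<lambda>i. t * of_bool (i \<in> S)"] S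
    by (simp add: sets_cap)
qed

text \<open>Adding \<open>c\<close> to every entry of a vector adds \<open>c * j\<close> to its
  support numbers and moves the body by the constant vector \<open>c\<close>.\<close>

lemma measure_shadow_translate:
  assumes h': "\<And>j. h' j = h j + c * real j"
  shows "measure (Pi\<^sub>M {..<m} (\<lambda>_. lborel)) (shadow {..<m} h') =
    measure (Pi\<^sub>M {..<m} (\<lambda>_. lborel)) (shadow {..<m} h)"
proof -
  let ?T = "\<lambda>c z. \<lambda>i\<in>{..<m}. z i + c :: real"
  have iff: "?T c z \<in> shadow {..<m} h' \<longleftrightarrow> z \<in> shadow {..<m} h" if z: "z \<in> extensional {..<m}" for z
  proof -
    have "sum (?T c z) S \<le> h' (card S) \<and> h' (Suc m) - h' (Suc m - card S) \<le> sum (?T c z) S \<longleftrightarrow>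
      sum z S \<le> h (card S) \<and> h (Suc m) - h (Suc m - card S) \<le> sum z S" if S: "S \<subseteq> {..<m}" for S
    proof -
      have "sum (?T c z) S = (\<Sum>i\<in>S. z i + c)" using S by (intro sum.cong) auto
      then have "sum (?T c z) S = sum z S + c * real (card S)" by (simp add: sum.distrib mult.commute)
      moreover have "real (Suc m - card S) = real (Suc m) - real (card S)"
        using card_mono[OF _ S] by (simp add: of_nat_diff)
      ultimately show ?thesis
        using h'[of "card S"] h'[of "Suc m"] h'[of "Suc m - card S"] by (simp add: right_diff_distrib)
    qed
    then show ?thesis using z by (simp add: shadow_def)
  qed
  have "shadow {..<m} h' = ?T c ` shadow {..<m} h"
  proof (intro equalityI subsetI)
    fix z assume z: "z \<in> shadow {..<m} h'"
    then have ext: "z \<in> extensional {..<m}" by (simp add: shadow_def)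
    then have "z = ?T c (?T (- c) z)" by (auto simp: extensional_def)
    moreover from this have "?T (- c) z \<in> shadow {..<m} h" using iff[of "?T (- c) z"] z by simp
    ultimately show "z \<in> ?T c ` shadow {..<m} h" by blast
  next
    fix z assume "z \<in> ?T c ` shadow {..<m} h"
    then obtain w where w: "z = ?T c w" "w \<in> shadow {..<m} h" by blast
    then have "w \<in> extensional {..<m}" by (simp add: shadow_def)
    then show "z \<in> shadow {..<m} h'" using iff[of w] w by simp
  qed
  then show ?thesis
    using measure_PiM_lborel_translate[of "{..<m}" "shadow {..<m} h" "\<lambda>_. c"] by (simp add: sets_shadow)
qed

section \<open>Mixed Eulerian numbers as differences of the volume polynomial\<close>

text \<open>
  Fundamental weight and simple root of type A; coordinates are numbered from \<open>0\<close>, so \<open>alpha k\<close>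
  lives on the coordinates \<open>k - 1\<close> and \<open>k\<close>.
\<close>

definition omega :: "nat \<Rightarrow> nat \<Rightarrow> real" where
  "omega k i = of_bool (i < k)"

definition alpha :: "nat \<Rightarrow> nat \<Rightarrow> real" where
  "alpha k i = of_bool (Suc i = k) - of_bool (i = k)"

definition is_volume :: "nat \<Rightarrow> ((nat \<Rightarrow> real) \<Rightarrow> real) \<Rightarrow> bool" where
  "is_volume m F \<longleftrightarrow> (\<forall>x. decr m x \<longrightarrow> 0 \<le> F x \<and>
     emeasure (Pi\<^sub>M {..<m} (\<lambda>_. lborel)) (shadow {..<m} (psum x)) = ennreal (F x))"

lemma is_volume_measure:
  assumes "is_volume m F" "decr m x"
  shows "measure (Pi\<^sub>M {..<m} (\<lambda>_. lborel)) (shadow {..<m} (psum x)) = F x"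
  using assms by (simp add: is_volume_def measure_def)

lemma decr_add: "decr m x \<Longrightarrow> decr m y \<Longrightarrow> decr m (\<lambda>i. x i + y i)"
  by (auto simp: decr_def intro: add_mono)

lemma decr_omega: "decr m (omega k)"
  by (auto simp: decr_def omega_def)

lemma decr_sum: "(\<And>t. t \<in> S \<Longrightarrow> decr m (v t)) \<Longrightarrow> decr m (\<lambda>i. \<Sum>t\<in>S. v t i)"
  by (auto simp: decr_def intro: sum_mono)

lemma psum_add: "psum (\<lambda>i. x i + y i) k = psum x k + psum y k"
  by (simp add: psum_def sum.distrib)

lemma psum_omega: "psum (omega k) j = real (min j k)"
  by (induction j) (auto simp: omega_def)

text \<open>The entries 1 and -1 cancel except in the partial sum that ends between them, so adding
  \<open>alpha k\<close> to a vector bumps only its \<open>k\<close>-th support number.\<close>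

lemma psum_alpha: "1 \<le> k \<Longrightarrow> psum (alpha k) j = of_bool (j = k)"
  by (induction j) (auto simp: alpha_def)

text \<open>The growth along \<open>alpha k\<close> is the total volume of the caps, and adding
  \<open>omega k\<close> to the vector leaves each cap volume unchanged. Both \<open>x\<close> and
  \<open>x + alpha k\<close> must be decreasing for \<open>F\<close> to measure volumes
  there.\<close>

lemma volume_alpha_omega:
  assumes F: "is_volume m F" and k: "1 \<le> k" "k \<le> m"
    and x: "decr m x" "decr m (\<lambda>i. x i + alpha k i)"
  shows "F (\<lambda>i. x i + alpha k i + omega k i) - F (\<lambda>i. x i + alpha k i) = F (\<lambda>i. x i + omega k i) - F x"
proof -
  let ?M = "Pi\<^sub>M {..<m} (\<lambda>_. lborel :: real measure)"
  let ?caps = "\<lambda>h. \<Sum>S | S \<subseteq> {..<Suc m} \<and> card S = k. measure ?M (cap m k 1 h S)"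
  have bump: "psum (\<lambda>i. x i + alpha k i) = bump k 1 (psum x)" for x
    using k by (auto simp: psum_add psum_alpha bump_def)
  have step: "F (\<lambda>i. x i + alpha k i) = F x + ?caps (psum x)"
    if "decr m x" "decr m (\<lambda>i. x i + alpha k i)" for x
  proof -
    have "emeasure ?M (shadow {..<m} (bump k 1 (psum x))) \<noteq> \<infinity>"
      using F that(2) unfolding bump[symmetric] is_volume_def by (metis ennreal_neq_top infinity_ennreal_def)
    then show ?thesis
      using measure_shadow_bump[OF that(1) k(2), of 1] is_volume_measure[OF F that(1)]
        is_volume_measure[OF F that(2)] by (simp add: bump)
  qed
  have "decr m (\<lambda>i. x i + omega k i)" "decr m (\<lambda>i. x i + omega k i + alpha k i)"
    using decr_add[OF x(1) decr_omega[of m k]] decr_add[OF x(2) decr_omega[of m k]]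
    by (simp_all add: add_ac)
  note step[OF this] step[OF x]
  moreover have "?caps (psum (\<lambda>i. x i + omega k i)) = ?caps (psum x)"
    by (intro sum.cong refl measure_cap_translate[OF x(1) k(2), of 1])
      (auto simp: psum_add psum_omega)
  ultimately show ?thesis by (simp add: add_ac)
qed

lemma volume_translate:
  assumes F: "is_volume m F" and x: "decr m x"
  shows "F (\<lambda>i. x i + omega (Suc m) i) = F x"
proof -
  have "shadow {..<m} (psum (\<lambda>i. x i + omega (Suc m) i)) = shadow {..<m} (\<lambda>j. psum x j + 1 * real j)"
    by (rule shadow_cong) (auto simp: psum_add psum_omega simp del: psum_Suc)
  then show ?thesis
    using is_volume_measure[OF F x] is_volume_measure[OF F decr_add[OF x decr_omega]]
      measure_shadow_translate[of "\<lambda>j. psum x j + 1 * real j" "psum x" 1 m] by metis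
qed

section \<open>Differences with prescribed levels\<close>

definition mixed_coeff :: "((nat \<Rightarrow> real) \<Rightarrow> real) \<Rightarrow> nat \<Rightarrow> (nat \<Rightarrow> nat) \<Rightarrow> real" where
  "mixed_coeff F m js = polarize F (\<lambda>_. 0) (\<lambda>t. omega (js t)) {..<m}"

lemma mixed_coeff_upd:
  fixes F :: "(nat \<Rightarrow> real) \<Rightarrow> real" and js :: "nat \<Rightarrow> nat"
  assumes "p < m"
  defines "H \<equiv> \<lambda>x. polarize F x (\<lambda>t. omega (js t)) ({..<m} - {p})"
  shows "mixed_coeff F m (js(p := j)) = H (omega j) - H (\<lambda>_. 0)"
proof -
  have "{..<m} = insert p ({..<m} - {p})" using assms by auto
  then have "mixed_coeff F m (js(p := j)) =
      polarize F (\<lambda>_. 0) (\<lambda>t. omega ((js(p := j)) t)) (insert p ({..<m} - {p}))"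
    by (simp add: mixed_coeff_def)
  also have "\<dots> = polarize F (omega j) (\<lambda>t. omega ((js(p := j)) t)) ({..<m} - {p}) -
      polarize F (\<lambda>_. 0) (\<lambda>t. omega ((js(p := j)) t)) ({..<m} - {p})"
    by (subst polarize_insert) auto
  finally have "mixed_coeff F m (js(p := j)) = \<dots>" .
  moreover have "polarize F x (\<lambda>t. omega ((js(p := j)) t)) ({..<m} - {p}) = H x" for x
    unfolding H_def by (rule polarize_cong) auto
  ultimately show ?thesis by simp
qed

text \<open>Level 0 is the zero vector and level \<open>m + 1\<close> a translation along the
  constant vector; a difference of \<open>F\<close> along either vanishes.\<close>

lemma mixed_coeff_eq_0:
  assumes "is_volume m F" "p < m" "js p = 0 \<or> js p = Suc m"
  shows "mixed_coeff F m js = 0"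
proof -
  let ?H = "\<lambda>x. polarize F x (\<lambda>t. omega (js t)) ({..<m} - {p})"
  have "?H (omega (js p)) = ?H (\<lambda>_. 0)"
    using assms(3)
  proof
    assume "js p = 0"
    then have "omega (js p) = (\<lambda>_. 0)" by (auto simp: omega_def)
    then show ?thesis by simp
  next
    assume "js p = Suc m"
    have "F (\<lambda>i. omega (Suc m) i + (\<Sum>t\<in>S. omega (js t) i)) = F (\<lambda>i. 0 + (\<Sum>t\<in>S. omega (js t) i))" for S
      using volume_translate[OF assms(1) decr_sum[of S m "\<lambda>t. omega (js t)"]] decr_omega
      by (simp add: add.commute)
    then show ?thesis using \<open>js p = Suc m\<close> unfolding polarize_def by simp
  qed
  then show ?thesis using mixed_coeff_upd[OF assms(2), of F js "js p"] by simp
qed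

text \<open>Without position \<open>p\<close>, the remaining \<open>m - 1\<close> differences make
  \<open>F\<close> an affine function \<open>H\<close> of the base point with additive increment
  \<open>h\<close>. The difference along \<open>omega k\<close> at position \<open>q\<close> gives
  \<open>h (alpha k) = 0\<close>, and
  \<open>2 * omega k = alpha k + omega (k - 1) + omega (k + 1)\<close>.\<close>

lemma mixed_coeff_three_term:
  assumes F: "is_volume m F" "dpoly m F" and pq: "p < m" "q < m" "p \<noteq> q"
    and k: "js p = k" "js q = k" "1 \<le> k" "k \<le> m"
  shows "2 * mixed_coeff F m js = mixed_coeff F m (js(p := k - 1)) + mixed_coeff F m (js(p := Suc k))"
proof -
  let ?v = "\<lambda>t. omega (js t)"
  let ?N = "{..<m} - {p}" and ?N' = "{..<m} - {p} - {q}"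
  define H where "H x = polarize F x ?v ?N" for x
  define h where "h w = H w - H (\<lambda>_. 0)" for w
  have upd: "mixed_coeff F m (js(p := j)) = h (omega j)" for j
    unfolding h_def H_def by (rule mixed_coeff_upd[OF pq(1)])
  have card: "Suc (card ?N) = m" using pq(1) by simp
  have aff: "H (\<lambda>i. x i + w i) - H x = h w" for x w
    unfolding h_def H_def by (rule polarize_affine) (simp_all only: card F finite_Diff finite_lessThan)
  then have add: "h (\<lambda>i. x i + w i) = h x + h w" for x w
    using aff[of x w] unfolding h_def by linarith
  have H: "H x = (\<Sum>S\<in>Pow ?N'. (- 1) ^ card (?N' - S) *
      (F (\<lambda>i. (x i + (\<Sum>t\<in>S. ?v t i)) + omega k i) - F (\<lambda>i. x i + (\<Sum>t\<in>S. ?v t i))))" for x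
  proof -
    have "?N = insert q ?N'" using pq by auto
    then have "H x = polarize F x ?v (insert q ?N')" by (simp add: H_def)
    also have "\<dots> = polarize F (\<lambda>i. x i + omega k i) ?v ?N' - polarize F x ?v ?N'"
      using k by (subst polarize_insert) auto
    finally show ?thesis
      by (simp add: polarize_def sum_subtractf right_diff_distrib add_ac)
  qed
  \<comment> \<open>The increment of \<open>H\<close> may be computed at any base point; here the
    gaps of size 1 are wide enough for \<open>x + alpha k\<close> to remain decreasing.\<close>
  define x :: "nat \<Rightarrow> real" where "x i = - real i" for i
  have x: "decr m x" "decr m (\<lambda>i. x i + alpha k i)"
    by (auto simp: decr_def x_def alpha_def)
  have "H (\<lambda>i. x i + alpha k i) = H x"
    unfolding H
  proof (intro sum.cong refl arg_cong2[of _ _ _ _ "(*)"])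
    fix S
    let ?s = "\<lambda>i. \<Sum>t\<in>S. ?v t i"
    have s: "decr m ?s" by (intro decr_sum decr_omega)
    show "F (\<lambda>i. x i + alpha k i + ?s i + omega k i) - F (\<lambda>i. x i + alpha k i + ?s i) =
      F (\<lambda>i. x i + ?s i + omega k i) - F (\<lambda>i. x i + ?s i)"
      using volume_alpha_omega[OF F(1) k(3,4), of "\<lambda>i. x i + ?s i"]
        decr_add[OF x(1) s] decr_add[OF x(2) s] by (simp add: add_ac)
  qed
  then have "h (alpha k) = 0" using aff[of x "alpha k"] by simp
  moreover have "(\<lambda>i. omega k i + omega k i) = (\<lambda>i. alpha k i + (omega (k - 1) i + omega (Suc k) i))"
    using k by (auto simp: omega_def alpha_def fun_eq_iff)
  then have "h (omega k) + h (omega k) = h (alpha k) + (h (omega (k - 1)) + h (omega (Suc k)))"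
    using add[of "omega k" "omega k"] add[of "omega (k - 1)" "omega (Suc k)"]
      add[of "alpha k" "\<lambda>i. omega (k - 1) i + omega (Suc k) i"] by simp
  moreover have "js(p := k) = js" using k by auto
  ultimately show ?thesis using upd[of k] upd[of "k - 1"] upd[of "Suc k"] by simp
qed

section \<open>Normalisation and identification with mixed volumes\<close>

lemma sum_Pow_card:
  fixes g :: "nat \<Rightarrow> real"
  assumes "finite N"
  shows "(\<Sum>S\<in>Pow N. g (card S)) = (\<Sum>q\<le>card N. real (card N choose q) * g q)"
proof -
  have "(\<Sum>S\<in>Pow N. g (card S)) = (\<Sum>q\<le>card N. \<Sum>S\<in>{S\<in>Pow N. card S = q}. g (card S))"
    using assms by (intro sum.group[symmetric]) (auto intro: card_mono)
  also have "\<dots> = (\<Sum>q\<le>card N. real (card N choose q) * g q)"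
    using n_subsets[OF assms] by (intro sum.cong refl) simp
  finally show ?thesis .
qed

lemma dpoly_power: "dpoly d (\<lambda>u. u j ^ d)"
proof (induction d)
  case 0 show ?case using dpoly_const[of 0 1] by simp
next
  case (Suc d) then show ?case using dpoly_mult[of d "\<lambda>u. u j ^ d" j] by simp
qed

text \<open>One difference of the power \<open>n + 1\<close> has leading term \<open>n + 1\<close>
  times the power \<open>n\<close>; the lower powers are annihilated by the remaining
  \<open>n\<close> differences.\<close>

lemma polarize_power:
  assumes "finite N" "\<And>t. t \<in> N \<Longrightarrow> v t j = 1"
  shows "polarize (\<lambda>u. u j ^ card N) x v N = fact (card N)"
  using assms
proof (induction N arbitrary: x rule: finite_induct)
  case empty show ?case by (simp add: polarize_def)
next
  case (insert t N)
  let ?n = "card N"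
  let ?P = "\<lambda>d. polarize (\<lambda>u. u j ^ d) x v N"
  have "polarize (\<lambda>u. u j ^ Suc ?n) x v (insert t N) =
      polarize (\<lambda>u. (u j + 1) ^ Suc ?n - u j ^ Suc ?n) x v N"
    using insert.hyps insert.prems polarize_difference[of "\<lambda>u. u j ^ Suc ?n" x "v t" v N]
    by (simp add: polarize_insert del: power_Suc)
  also have "(\<lambda>u. (u j + 1) ^ Suc ?n - u j ^ Suc ?n) =
      (\<lambda>u :: nat \<Rightarrow> real. \<Sum>d\<le>?n. real (Suc ?n choose d) * u j ^ d)"
    by (subst binomial_ring) (simp add: fun_eq_iff del: power_Suc)
  also have "polarize (\<lambda>u. \<Sum>d\<le>?n. real (Suc ?n choose d) * u j ^ d) x v N =
      (\<Sum>d\<le>?n. real (Suc ?n choose d) * ?P d)"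
    unfolding polarize_def sum_distrib_left
    by (subst sum.swap) (simp add: mult_ac)
  also have "\<dots> = (\<Sum>d\<in>{?n}. real (Suc ?n choose d) * ?P d)"
    using polarize_vanishes[OF insert.hyps(1) dpoly_power]
    by (intro sum.mono_neutral_right) auto
  also have "\<dots> = fact (Suc ?n)"
    using insert.IH insert.prems by simp
  finally show ?case using insert.hyps by simp
qed

text \<open>Sums of copies of \<open>omega 1\<close> are vectors \<open>(c, 0, ..., 0)\<close>,
  where \<open>F\<close> is \<open>c ^ m / m!\<close>, and the \<open>m\<close>-th difference of the
  \<open>m\<close>-th power is \<open>m!\<close>. This value determines the scale of the
  solution.\<close>

lemma mixed_coeff_ones:
  assumes "\<And>c. 0 \<le> c \<Longrightarrow> F (\<lambda>i. if i = 0 then c else 0) = c ^ m / fact m"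
  shows "mixed_coeff F m (\<lambda>_. 1) = 1"
proof -
  have "polarize F (\<lambda>_. 0) (\<lambda>_. omega 1) {..<m} =
      (\<Sum>S\<in>Pow {..<m}. (- 1) ^ card ({..<m} - S) * (real (card S) ^ m / fact m))"
    unfolding polarize_def
  proof (intro sum.cong refl arg_cong2[of _ _ _ _ "(*)"])
    fix S :: "nat set"
    have "(\<lambda>i. 0 + (\<Sum>t\<in>S. omega 1 i)) = (\<lambda>i. if i = 0 then real (card S) else 0)"
      by (auto simp: omega_def)
    then show "F (\<lambda>i. 0 + (\<Sum>t\<in>S. omega 1 i)) = real (card S) ^ m / fact m"
      using assms[of "card S"] by simp
  qed
  also have "\<dots> = polarize (\<lambda>u. u 0 ^ m) (\<lambda>_. 0) (\<lambda>_ _. 1) {..<m} / fact m"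
    by (simp add: polarize_def sum_divide_distrib)
  also have "\<dots> = 1" using polarize_power[of "{..<m}" "\<lambda>_ _. 1" 0 "\<lambda>_. 0"] by simp
  finally show ?thesis by (simp add: mixed_coeff_def)
qed

text \<open>Composed with \<open>step_weights\<close>, \<open>F\<close> is a volume polynomial in
  the weights. Its squarefree coefficient is the signed sum over 0-1 weights, which is the iterated
  difference along the \<open>omega (js t)\<close>.\<close>

lemma mixed_volume_hypersimplices:
  assumes F: "is_volume m F" "hpoly n m F" and js: "\<And>t. t < m \<Longrightarrow> js t \<le> m"
  shows "fact m * mixed_volume m (\<lambda>t. hypersimplex0 m (js t)) = mixed_coeff F m js"
proof -
  let ?K = "\<lambda>t. hypersimplex0 m (js t)"
  have "hpoly m m (\<lambda>l. F (step_weights m l js))"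
    using hpoly_linear_subst[OF F(2), of m "\<lambda>t i. of_bool (i < js t)"]
    unfolding step_weights_def[abs_def] .
  then obtain c where c: "\<And>l. F (step_weights m l js) =
      (\<Sum>\<alpha>\<in>exponents m. c \<alpha> * (\<Prod>t<m. l t ^ \<alpha> t))"
    unfolding exponents_eq using hpoly_monomials by fastforce
  have "volume_polynomial m ?K c"
    unfolding volume_polynomial_def
  proof (intro allI impI)
    fix l :: "nat \<Rightarrow> real" assume "\<forall>t<m. 0 \<le> l t"
    then show "lattice_volume m (minkowski_comb m l ?K) = (\<Sum>\<alpha>\<in>exponents m. c \<alpha> * (\<Prod>t<m. l t ^ \<alpha> t))"
      using lattice_volume_minkowski_comb[OF _ js, of l] decr_step_weights[of m l m js]
        is_volume_measure[OF F(1)] c by simp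
  qed
  then have "fact m * mixed_volume m ?K = c (\<lambda>t\<in>{..<m}. 1)"
    by (simp add: mixed_volume_eq)
  also have "\<dots> = (\<Sum>S\<in>Pow {..<m}. (- 1) ^ card ({..<m} - S) *
      F (step_weights m (\<lambda>t. of_bool (t \<in> S)) js))"
    unfolding c squarefree_coefficient ..
  also have "\<dots> = mixed_coeff F m js"
    unfolding mixed_coeff_def polarize_def
  proof (intro sum.cong refl arg_cong2[of _ _ _ _ "(*)"] arg_cong[of _ _ F] ext)
    fix S i assume "S \<in> Pow {..<m}"
    then have "(\<Sum>t\<in>{..<m}. of_bool (t \<in> S) * omega (js t) i) = (\<Sum>t\<in>S. omega (js t) i)"
      by (intro sum.mono_neutral_cong_right) auto
    then show "step_weights m (\<lambda>t. of_bool (t \<in> S)) js i = 0 + (\<Sum>t\<in>S. omega (js t) i)"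
      by (simp only: step_weights_def omega_def)
  qed
  finally show ?thesis .
qed

section \<open>The three-term relation and its solution\<close>

lemma mixed_coeff_cong:
  "(\<And>t. t < m \<Longrightarrow> js t = js' t) \<Longrightarrow> mixed_coeff F m js = mixed_coeff F m js'"
  unfolding mixed_coeff_def by (intro polarize_cong) auto

lemma mixed_coeff_mset:
  assumes "mset xs = mset ys"
  shows "mixed_coeff F (length xs) (nth xs) = mixed_coeff F (length ys) (nth ys)"
proof -
  obtain p where p: "p permutes {..<length ys}" "permute_list p ys = xs"
    using mset_eq_permutation[OF assms] .
  have "mixed_coeff F (length xs) (nth xs) = mixed_coeff F (length ys) (\<lambda>t. ys ! p t)"
    using p by (auto simp: permute_list_nth mset_eq_length[OF assms] intro!: mixed_coeff_cong)
  also have "\<dots> = mixed_coeff F (length ys) (nth ys)"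
    unfolding mixed_coeff_def
    using polarize_permute[OF permutes_imp_bij[OF p(1)], of F _ "\<lambda>t. omega (ys ! t)"] by simp
  finally show ?thesis .
qed

definition mixed_coeff_multiset :: "((nat \<Rightarrow> real) \<Rightarrow> real) \<Rightarrow> nat multiset \<Rightarrow> real" where
  "mixed_coeff_multiset F M = mixed_coeff F (size M) (nth (sorted_list_of_multiset M))"

lemma mixed_coeff_multiset_mset:
  "mixed_coeff_multiset F (mset xs) = mixed_coeff F (length xs) (nth xs)"
  using mixed_coeff_mset[of "sorted_list_of_multiset (mset xs)" xs F]
  by (simp add: mixed_coeff_multiset_def flip: size_mset)

lemma mixed_coeff_multiset_eq_0:
  assumes "is_volume (size M) F" "0 \<in># M \<or> Suc (size M) \<in># M"
  shows "mixed_coeff_multiset F M = 0"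
proof -
  obtain xs where xs: "M = mset xs" by (metis ex_mset)
  then obtain p where "p < length xs" "xs ! p = 0 \<or> xs ! p = Suc (length xs)"
    using assms(2) by (auto simp: in_set_conv_nth)
  then show ?thesis
    using mixed_coeff_eq_0[of "length xs" F p "nth xs"] assms(1) by (simp add: xs mixed_coeff_multiset_mset)
qed

lemma mixed_coeff_multiset_three_term:
  assumes "is_volume (Suc (Suc (size N))) F" "dpoly (Suc (Suc (size N))) F"
    and "1 \<le> k" "k \<le> Suc (Suc (size N))"
  shows "2 * mixed_coeff_multiset F (add_mset k (add_mset k N)) =
    mixed_coeff_multiset F (add_mset (k - 1) (add_mset k N)) +
    mixed_coeff_multiset F (add_mset (Suc k) (add_mset k N))"
proof -
  obtain xs where xs: "N = mset xs" by (metis ex_mset)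
  let ?m = "Suc (Suc (length xs))"
  have upd: "(nth (k # k # xs))(0 := j) = nth (j # k # xs)" for j
    by (auto simp: fun_eq_iff nth_Cons split: nat.split)
  have *: "mixed_coeff_multiset F (add_mset j (add_mset k N)) = mixed_coeff F ?m (nth (j # k # xs))" for j
    using mixed_coeff_multiset_mset[of F "j # k # xs"] by (simp add: xs)
  show ?thesis
    using mixed_coeff_three_term[of ?m F 0 1 "nth (k # k # xs)" k] assms
    unfolding * upd by (simp add: xs)
qed

section \<open>Alternating sums\<close>

text \<open>
  The subtraction \<open>c - q\<close> is truncated; this cuts the sum off at the smallest element of \<open>M\<close>, as
  required for the coefficient of \<open>y ^ i\<close> when \<open>M\<close> starts at \<open>i + 1\<close>.
\<close>

definition alt_sum :: "nat \<Rightarrow> nat multiset \<Rightarrow> real" where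
  "alt_sum m M = (\<Sum>q\<le>Suc m. (- 1) ^ q * real (Suc m choose q) * (\<Prod>c\<in>#M. real (c - q)))"

text \<open>With truncated subtraction, \<open>k - q\<close> is the mean of its neighbours except at
  \<open>q = k\<close>, where the factor of the second copy of \<open>k\<close> is zero.\<close>

lemma alt_sum_three_term:
  assumes "1 \<le> k"
  shows "2 * alt_sum m (add_mset k (add_mset k N)) =
    alt_sum m (add_mset (k - 1) (add_mset k N)) + alt_sum m (add_mset (Suc k) (add_mset k N))"
proof -
  have "2 * (real (k - q) * (real (k - q) * P)) =
      real (k - 1 - q) * (real (k - q) * P) + real (Suc k - q) * (real (k - q) * P)" for q and P :: real
  proof (cases "q < k")
    case True
    then have "2 * real (k - q) = real (k - 1 - q) + real (Suc k - q)" by simp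
    then show ?thesis by (simp only: mult.assoc[symmetric] distrib_right)
  qed simp
  then show ?thesis
    by (simp add: alt_sum_def sum_distrib_left sum.distrib[symmetric] mult.left_commute[of 2] distrib_left[symmetric] del: sum.atMost_Suc)
qed

lemma alt_sum_eq_0_left: "0 \<in># M \<Longrightarrow> alt_sum m M = 0"
proof -
  assume "0 \<in># M"
  then have "(\<Prod>c\<in>#M. real (c - q)) = 0" for q by (auto simp: prod_mset_zero_iff image_iff)
  then show ?thesis by (simp only: alt_sum_def mult_zero_right sum.neutral_const)
qed

lemma dpoly_prod_mset: "dpoly (size M) (\<lambda>u. \<Prod>c\<in>#M. real c - u j)"
proof (induction M)
  case empty show ?case by (simp add: dpoly_const)
next
  case (add c M)
  have "dpoly (Suc (size M)) (\<lambda>u. real c * (\<Prod>c\<in>#M. real c - u j) + (- 1) * (u j * (\<Prod>c\<in>#M. real c - u j)))"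
    by (intro dpoly_add dpoly_cmult dpoly_mult dpoly_Suc[OF dpoly_cmult] add.IH)
  then show ?case by (simp add: left_diff_distrib)
qed

text \<open>Up to sign this is the \<open>n\<close>-th difference with steps 1 of a polynomial of
  degree below \<open>n\<close>, the subsets being grouped by size.\<close>

lemma alternating_binomial_prod_mset:
  assumes "size M < n"
  shows "(\<Sum>q\<le>n. (- 1) ^ q * real (n choose q) * (\<Prod>c\<in>#M. real c - real q)) = 0"
proof -
  let ?g = "\<lambda>q. (- 1) ^ q * (\<Prod>c\<in>#M. real c - real q)"
  have "0 = (- 1) ^ n * polarize (\<lambda>u. \<Prod>c\<in>#M. real c - u 0) (\<lambda>_. 0) (\<lambda>_ _. 1) {..<n}"
    using polarize_vanishes[OF _ dpoly_prod_mset, of "{..<n}"] assms by simp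
  also have "\<dots> = (\<Sum>S\<in>Pow {..<n}. ?g (card S))"
    unfolding polarize_def sum_distrib_left
  proof (intro sum.cong refl)
    fix S assume "S \<in> Pow {..<n}"
    then have "card ({..<n} - S) = n - card S" "card S \<le> n"
      using card_mono[of "{..<n}" S] finite_subset[of S "{..<n}"] by (auto simp: card_Diff_subset)
    then have "(- 1) ^ n * (- 1) ^ card ({..<n} - S) = ((- 1) ^ card S :: real)"
      by (simp add: power_add[symmetric] minus_one_power_iff)
    then show "(- 1) ^ n * ((- 1) ^ card ({..<n} - S) * (\<Prod>c\<in>#M. real c - (0 + (\<Sum>t\<in>S. 1)))) = ?g (card S)"
      by (simp add: mult.assoc[symmetric])
  qed
  also have "\<dots> = (\<Sum>q\<le>n. real (n choose q) * ?g q)"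
    using sum_Pow_card[of "{..<n}" ?g] by simp
  finally show ?thesis by (simp add: mult_ac)
qed

text \<open>For \<open>q\<close> below \<open>lo\<close> nothing is truncated, and any other
  \<open>q\<close> up to \<open>Suc m\<close> lies in \<open>M\<close>, so both products vanish.
  Truncation thus has no effect, and a difference of order \<open>m + 1\<close> annihilates degree
  at most \<open>m\<close>.\<close>

lemma alt_sum_eq_0_right:
  assumes "set_mset M = {lo..hi}" "Suc m \<le> hi" "size M \<le> m"
  shows "alt_sum m M = 0"
proof -
  have "(\<Prod>c\<in>#M. real (c - q)) = (\<Prod>c\<in>#M. real c - real q)" if "q \<le> Suc m" for q
  proof (cases "q < lo")
    case True
    then have "image_mset (\<lambda>c. real (c - q)) M = image_mset (\<lambda>c. real c - real q) M"
      using assms(1) by (intro image_mset_cong) auto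
    then show ?thesis by simp
  next
    case False
    then have "q \<in># M" using assms that by simp
    then have "0 \<in># image_mset (\<lambda>c. real (c - q)) M" "0 \<in># image_mset (\<lambda>c. real c - real q) M"
      by (auto simp: image_iff)
    then show ?thesis using prod_mset_zero_iff by metis
  qed
  then show ?thesis
    using alternating_binomial_prod_mset[of M "Suc m"] assms(3)
    by (simp add: alt_sum_def del: sum.atMost_Suc)
qed

section \<open>Uniqueness by a maximum principle\<close>

text \<open>Interval support is preserved when a repeated element is shifted by one, and it makes
  \<open>alt_sum\<close> vanish at the upper boundary level.\<close>

definition contiguous :: "nat \<Rightarrow> nat \<Rightarrow> nat \<Rightarrow> nat multiset \<Rightarrow> bool" where
  "contiguous m lo hi M \<longleftrightarrow> size M = m \<and> lo \<le> hi \<and> set_mset M = {lo..hi}"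

lemma contiguous_mem:
  assumes "contiguous m lo hi (add_mset k N)"
  shows "k \<in> {lo..hi}"
proof -
  have "set_mset (add_mset k N) = {lo..hi}" using assms unfolding contiguous_def by blast
  then show ?thesis by (metis union_single_eq_member)
qed

text \<open>One copy of \<open>k\<close> stays behind, so the support loses nothing and grows at
  most at one end.\<close>

lemma contiguous_shift:
  assumes "contiguous m lo hi (add_mset k (add_mset k N))" "1 \<le> lo"
  shows "\<exists>lo' \<in> {lo - 1, lo}. contiguous m lo' hi (add_mset (k - 1) (add_mset k N))"
    "\<exists>hi' \<in> {hi, Suc hi}. contiguous m lo hi' (add_mset (Suc k) (add_mset k N))"
proof -
  have k: "insert k (set_mset N) = {lo..hi}" "size N + 2 = m" "lo \<le> hi"
    using assms by (auto simp: contiguous_def)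
  then have "k \<in> {lo..hi}" by blast
  then have "insert (k - 1) {lo..hi} = (if k = lo then {lo - 1..hi} else {lo..hi})"
    "insert (Suc k) {lo..hi} = (if k = hi then {lo..Suc hi} else {lo..hi})"
    using assms(2) by auto
  then show "\<exists>lo' \<in> {lo - 1, lo}. contiguous m lo' hi (add_mset (k - 1) (add_mset k N))"
    "\<exists>hi' \<in> {hi, Suc hi}. contiguous m lo hi' (add_mset (Suc k) (add_mset k N))"
    using k by (auto simp: contiguous_def split: if_splits)
qed

text \<open>Pigeonhole: without repetition, \<open>m\<close> elements fill all of
  \<open>{1..m}\<close>.\<close>

lemma multiset_repeated_element:
  assumes "size M = m" "set_mset M \<subseteq> {1..m}" "M \<noteq> mset_set {1..m}"
  obtains k N where "M = add_mset k (add_mset k N)"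
proof -
  have "\<exists>k. 2 \<le> count M k"
  proof (rule ccontr)
    assume "\<not> ?thesis"
    then have c: "count M k \<le> 1" for k by (metis not_less_eq_eq numeral_2_eq_2 One_nat_def)
    have eq: "M = mset_set (set_mset M)"
    proof (rule multiset_eqI)
      fix k show "count M k = count (mset_set (set_mset M)) k"
        using c[of k] by (cases "k \<in># M") (auto simp: not_in_iff dest: count_greater_zero_iff[THEN iffD2] intro: le_antisym)
    qed
    then have "card (set_mset M) = m" using assms(1) by (metis size_mset_set)
    then have "set_mset M = {1..m}" using assms(2) by (intro card_subset_eq) auto
    then show False using eq assms(3) by simp
  qed
  then obtain k where k: "2 \<le> count M k" by blast
  then have "k \<in># M" by (metis count_inI not_numeral_le_zero)
  then obtain M' where M': "M = add_mset k M'" by (metis mset_add)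
  then have "k \<in># M'" using k by (metis One_nat_def Suc_1 Suc_le_mono count_add_mset count_greater_eq_one_iff)
  then show thesis using that M' by (metis mset_add)
qed

lemma three_term_unique:
  fixes f :: "nat multiset \<Rightarrow> real"
  assumes base: "f (mset_set {1..m}) = 0"
    and rec: "\<And>k N lo hi. contiguous m lo hi (add_mset k (add_mset k N)) \<Longrightarrow> 1 \<le> lo \<Longrightarrow> hi \<le> m \<Longrightarrow>
      2 * f (add_mset k (add_mset k N)) =
      f (add_mset (k - 1) (add_mset k N)) + f (add_mset (Suc k) (add_mset k N))"
    and left: "\<And>hi M. contiguous m 0 hi M \<Longrightarrow> f M = 0"
    and right: "\<And>lo M. contiguous m lo (Suc m) M \<Longrightarrow> f M = 0"
    and M: "contiguous m lo hi M" "1 \<le> lo" "hi \<le> m"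
  shows "f M = 0"
proof -
  \<comment> \<open>Among the maximisers of \<open>\<bar>f\<bar>\<close>, one of minimal sum would have its left neighbour as another.\<close>
  define \<C> where "\<C> = {M. \<exists>lo hi. contiguous m lo hi M \<and> 1 \<le> lo \<and> hi \<le> m}"
  have "\<C> \<subseteq> multisets_of_size {1..m} m"
    by (fastforce simp: \<C>_def contiguous_def multisets_of_size_def)
  then have fin: "finite \<C>" by (rule finite_subset) auto
  define B where "B = Max ((\<lambda>M. \<bar>f M\<bar>) ` \<C>)"
  have M_in: "M \<in> \<C>" using M by (auto simp: \<C>_def)
  have le: "\<bar>f M\<bar> \<le> B" if "M \<in> \<C>" for M
    unfolding B_def using fin that by (intro Max_ge) auto
  have "B \<in> (\<lambda>M. \<bar>f M\<bar>) ` \<C>" unfolding B_def using fin M_in by (intro Max_in) auto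
  then obtain M0 where M0: "M0 \<in> \<C>" "\<bar>f M0\<bar> = B" by auto
  have False if "0 < B" "M' \<in> \<C>" "\<bar>f M'\<bar> = B" for M'
    using that(2,3)
  proof (induction "sum_mset M'" arbitrary: M' rule: less_induct)
    case less
    then obtain lo hi where c: "contiguous m lo hi M'" "1 \<le> lo" "hi \<le> m" by (auto simp: \<C>_def)
    have "M' \<noteq> mset_set {1..m}" using less.prems base \<open>0 < B\<close> by auto
    then obtain k N where M': "M' = add_mset k (add_mset k N)"
      using multiset_repeated_element[of M' m] c by (auto simp: contiguous_def)
    let ?L = "add_mset (k - 1) (add_mset k N)" and ?R = "add_mset (Suc k) (add_mset k N)"
    have "k \<in> {lo..hi}" by (rule contiguous_mem[OF c(1)[unfolded M']])
    then have k: "1 \<le> k" using c by simp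
    obtain lo' hi' where L: "contiguous m lo' hi ?L" and R: "contiguous m lo hi' ?R"
      and bounds: "lo' \<in> {lo - 1, lo}" "hi' \<in> {hi, Suc hi}"
      using contiguous_shift[OF c(1)[unfolded M'] c(2)] by blast
    have "\<bar>f ?R\<bar> \<le> B"
    proof (cases "hi' = Suc m")
      case True then show ?thesis using right R \<open>0 < B\<close> by auto
    next
      case False
      then have "hi' \<le> m" using bounds c by auto
      then have "?R \<in> \<C>" using R c by (auto simp: \<C>_def)
      then show ?thesis by (rule le)
    qed
    moreover have "2 * f M' = f ?L + f ?R" using rec c M' by blast
    \<comment> \<open>From \<open>2 * f M' = f ?L + f ?R\<close> with \<open>f M'\<close> of modulus
      \<open>B\<close> and \<open>f ?R\<close> of modulus at most \<open>B\<close>, the modulus of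
      \<open>f ?L\<close> is at least \<open>2 * B - B\<close>.\<close>
    ultimately have ge: "B \<le> \<bar>f ?L\<bar>" using less.prems(2) by linarith
    then have "f ?L \<noteq> 0" using \<open>0 < B\<close> by auto
    then have "lo' \<noteq> 0" using left L by metis
    then have "1 \<le> lo'" by simp
    then have "?L \<in> \<C>" unfolding \<C>_def using L c(3) by blast
    moreover have "sum_mset ?L < sum_mset M'" using k M' by simp
    ultimately show False using less.hyps[of ?L] ge le[of ?L] by simp
  qed
  then have "B \<le> 0" using M0 not_le by blast
  then show ?thesis using le[OF M_in] by simp
qed

text \<open>Both sides obey the relation and vanish at the boundary levels. With \<kappa> chosen so
  that the difference vanishes at \<open>{1..m}\<close>, uniqueness gives proportionality; at
  \<open>m\<close> copies of 1 both sides are 1, hence \<kappa> is 1.\<close>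

lemma mixed_coeff_multiset_eq_alt_sum:
  assumes F: "is_volume m F" "dpoly m F"
    and norm: "\<And>c. 0 \<le> c \<Longrightarrow> F (\<lambda>i. if i = 0 then c else 0) = c ^ m / fact m"
    and m: "1 \<le> m" and M: "contiguous m lo hi M" "1 \<le> lo" "hi \<le> m"
  shows "mixed_coeff_multiset F M = alt_sum m M"
proof -
  have base: "alt_sum m (mset_set {1..m}) = fact m"
  proof -
    \<comment> \<open>For \<open>q >= 1\<close> the factor of the element 1 is truncated to
      0.\<close>
    have "alt_sum m (mset_set {1..m}) = (\<Sum>q\<in>{0}. (- 1) ^ q * real (Suc m choose q) * (\<Prod>c\<in>{1..m}. real (c - q)))"
      unfolding alt_sum_def prod_unfold_prod_mset[symmetric] using m
      by (intro sum.mono_neutral_cong_right) (auto intro!: bexI[of _ 1])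
    then show ?thesis by (simp add: fact_prod)
  qed
  define \<kappa> where "\<kappa> = mixed_coeff_multiset F (mset_set {1..m}) / fact m"
  have vanish: "mixed_coeff_multiset F M - \<kappa> * alt_sum m M = 0"
    if "contiguous m lo hi M" "1 \<le> lo" "hi \<le> m" for lo hi M
  proof (rule three_term_unique[OF _ _ _ _ that])
    show "mixed_coeff_multiset F (mset_set {1..m}) - \<kappa> * alt_sum m (mset_set {1..m}) = 0"
      unfolding base \<kappa>_def by simp
  next
    fix k N lo hi assume c: "contiguous m lo hi (add_mset k (add_mset k N))" "1 \<le> lo" "hi \<le> m"
    then have "k \<in> {lo..hi}" "m = Suc (Suc (size N))"
      using contiguous_mem[OF c(1)] by (auto simp: contiguous_def)
    then have k: "1 \<le> k" "k \<le> m" "m = Suc (Suc (size N))" using c by auto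
    show "2 * (mixed_coeff_multiset F (add_mset k (add_mset k N)) - \<kappa> * alt_sum m (add_mset k (add_mset k N))) =
      mixed_coeff_multiset F (add_mset (k - 1) (add_mset k N)) - \<kappa> * alt_sum m (add_mset (k - 1) (add_mset k N)) +
      (mixed_coeff_multiset F (add_mset (Suc k) (add_mset k N)) - \<kappa> * alt_sum m (add_mset (Suc k) (add_mset k N)))"
      using mixed_coeff_multiset_three_term[of N F k] alt_sum_three_term[OF k(1), of m N] F k
      by (simp only: right_diff_distrib mult.left_commute[of 2 \<kappa>]) (simp add: distrib_left)
  next
    fix hi M assume "contiguous m 0 hi M"
    then have "0 \<in># M" "size M = m" by (auto simp: contiguous_def)
    then show "mixed_coeff_multiset F M - \<kappa> * alt_sum m M = 0"
      using mixed_coeff_multiset_eq_0 alt_sum_eq_0_left F by simp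
  next
    fix lo M assume "contiguous m lo (Suc m) M"
    then have "Suc m \<in># M" "size M = m" "set_mset M = {lo..Suc m}" by (auto simp: contiguous_def)
    then show "mixed_coeff_multiset F M - \<kappa> * alt_sum m M = 0"
      using mixed_coeff_multiset_eq_0 alt_sum_eq_0_right F by simp
  qed
  have "mixed_coeff_multiset F (replicate_mset m 1) = 1"
  proof -
    have "mixed_coeff_multiset F (mset (replicate m 1)) = mixed_coeff F m (\<lambda>_. 1)"
      unfolding mixed_coeff_multiset_mset by (auto intro!: mixed_coeff_cong)
    then show ?thesis using mixed_coeff_ones[OF norm] by simp
  qed
  moreover have "alt_sum m (replicate_mset m 1) = 1"
  proof -
    have "alt_sum m (replicate_mset m 1) = (\<Sum>q\<in>{0}. (- 1) ^ q * real (Suc m choose q) * real (1 - q) ^ m)"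
      unfolding alt_sum_def using m
      by (intro sum.mono_neutral_cong_right) (auto simp: power_0_left)
    then show ?thesis by simp
  qed
  moreover have "contiguous m 1 1 (replicate_mset m 1)"
    using m by (auto simp: contiguous_def)
  ultimately have "\<kappa> = 1" using vanish[of 1 1 "replicate_mset m 1"] m by simp
  then show ?thesis using vanish[OF M] by simp
qed

section \<open>Level lists and coefficients of the power series\<close>

text \<open>A recursive form of the list \<open>js\<close> in \<open>mixed_eulerian\<close>, with
  variable first level \<open>s\<close> so that induction and the removal of leading zeros are
  possible.\<close>

fun expand :: "nat \<Rightarrow> nat list \<Rightarrow> nat list" where
  "expand s [] = []"
| "expand s (x # xs) = replicate x s @ expand (Suc s) xs"

lemma concat_replicate_eq_expand:
  "concat (map (\<lambda>j. replicate (b ! (j - s)) j) [s..<s + length b]) = expand s b"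
proof (induction b arbitrary: s)
  case (Cons x b)
  have "map (\<lambda>j. replicate ((x # b) ! (j - s)) j) [Suc s..<Suc s + length b] =
      map (\<lambda>j. replicate (b ! (j - Suc s)) j) [Suc s..<Suc s + length b]"
    by (intro map_cong refl) (auto simp: nth_Cons Suc_diff_Suc[symmetric] split: nat.split)
  moreover have "[s..<s + length (x # b)] = s # [Suc s..<Suc s + length b]"
    by (simp add: upt_conv_Cons del: upt_Suc)
  ultimately show ?case using Cons.IH[of "Suc s"]
    by (simp only: list.map concat.simps expand.simps) simp
qed simp

lemma expand_append: "expand s (xs @ ys) = expand s xs @ expand (s + length xs) ys"
  by (induction xs arbitrary: s) auto

lemma expand_zeros: "expand s (replicate n 0) = []"
  by (induction n arbitrary: s) auto

lemma length_expand: "length (expand s xs) = sum_list xs"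
  by (induction xs arbitrary: s) auto

lemma set_expand: "set (expand s xs) \<subseteq> {s..<s + length xs}"
proof (induction xs arbitrary: s)
  case (Cons x xs)
  have "set (expand s (x # xs)) \<subseteq> insert s {Suc s..<Suc s + length xs}"
    using Cons.IH[of "Suc s"] by (auto simp: set_replicate_conv_if)
  then show ?case by auto
qed simp

lemma set_expand_pos: "(\<And>x. x \<in> set xs \<Longrightarrow> 1 \<le> x) \<Longrightarrow> set (expand s xs) = {s..<s + length xs}"
proof (induction xs arbitrary: s)
  case (Cons x xs)
  have "set (expand s (x # xs)) = insert s {Suc s..<Suc s + length xs}"
  proof -
    have "set (expand (Suc s) xs) = {Suc s..<Suc s + length xs}"
      using Cons.prems by (intro Cons.IH) simp
    moreover have "x \<noteq> 0" using Cons.prems[of x] by simp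
    ultimately show ?thesis by simp
  qed
  also have "\<dots> = {s..<s + length (x # xs)}" by auto
  finally show ?case .
qed simp

lemma prod_mset_expand:
  fixes g :: "nat \<Rightarrow> real"
  shows "(\<Prod>c\<in>#mset (expand s xs). g c) = (\<Prod>j<length xs. g (s + j) ^ (xs ! j))"
proof (induction xs arbitrary: s)
  case (Cons x xs)
  have "(\<Prod>c\<in>#mset (expand s (x # xs)). g c) = g s ^ x * (\<Prod>c\<in>#mset (expand (Suc s) xs). g c)"
    by simp
  also have "\<dots> = g (s + 0) ^ ((x # xs) ! 0) * (\<Prod>j<length xs. g (s + Suc j) ^ ((x # xs) ! Suc j))"
    unfolding Cons.IH by simp
  also have "\<dots> = (\<Prod>j<length (x # xs). g (s + j) ^ ((x # xs) ! j))"
    unfolding list.size(4) add_0_right add_Suc_right prod.lessThan_Suc_shift nth_Cons_0 nth_Cons_Suc ..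
  finally show ?case .
qed simp

lemma mixed_eulerian_eq_mixed_coeff:
  assumes "is_volume (length b) F" "hpoly n (length b) F" "sum_list b = length b"
  shows "mixed_eulerian b = mixed_coeff_multiset F (mset (expand 1 b))"
proof -
  let ?js = "expand 1 b"
  have len: "length ?js = length b" using assms(3) by (simp add: length_expand)
  have "mixed_eulerian b = fact (length b) * mixed_volume (length b) (\<lambda>t. hypersimplex0 (length b) (?js ! t))"
    using concat_replicate_eq_expand[of b 1] by (simp add: mixed_eulerian_def Let_def)
  also have "\<dots> = mixed_coeff F (length b) (nth ?js)"
  proof (rule mixed_volume_hypersimplices[OF assms(1,2)])
    fix t assume "t < length b"
    then have "?js ! t \<in> set ?js" using len by simp
    then show "?js ! t \<le> length b" using set_expand[of 1 b] by auto
  qed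
  finally show ?thesis using len by (simp add: mixed_coeff_multiset_mset)
qed

lemma one_minus_fps_X_power_nth: "fps_nth ((1 - fps_X) ^ n) q = (- 1) ^ q * (real (n choose q) :: real)"
proof -
  have "(1 - fps_X :: real fps) ^ n = (\<Sum>k\<le>n. of_nat (n choose k) * (- fps_X) ^ k * 1 ^ (n - k))"
    using binomial_ring[of "- fps_X :: real fps" 1 n] by simp
  also have "\<dots> = (\<Sum>k\<le>n. fps_const ((- 1) ^ k * real (n choose k)) * fps_X ^ k)"
    by (intro sum.cong refl) (simp add: power_minus[of fps_X] fps_of_nat fps_const_mult[symmetric] fps_const_power[symmetric] fps_const_neg[symmetric] mult_ac del: fps_const_mult fps_const_power fps_const_neg)
  finally show ?thesis
    by (simp add: fps_sum_nth fps_X_power_iff if_distrib[of "\<lambda>x. _ * x"] cong: if_cong)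
qed

theorem theorem7p13:
  fixes k r :: nat and a :: "nat list"
  assumes "1 \<le> k" and "length a = k" and "\<forall>j<k. 1 \<le> a ! j" and "sum_list a = r"
  shows "fps_of_poly (mixed_eulerian_poly a) =
           (1 - fps_X) ^ (r + 1) *
           Abs_fps (\<lambda>i. \<Prod>j<k. (real i + real (j + 1)) ^ (a ! j))"
proof (rule fps_ext)
  fix n
  let ?R = "fps_nth ((1 - fps_X) ^ (r + 1) *
    Abs_fps (\<lambda>i. \<Prod>j<k. (real i + real (j + 1)) ^ (a ! j)))"
  \<comment> \<open>These are the levels of \<open>a\<close> preceded by \<open>n\<close> zeros,
    which push the first level to \<open>n + 1\<close>.\<close>
  let ?M = "mset (expand (Suc n) a)"
  have pos: "1 \<le> x" if "x \<in> set a" for x using that assms(2,3) by (auto simp: in_set_conv_nth)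
  have set: "set_mset ?M = {Suc n..n + k}" and size: "size ?M = r"
    using set_expand_pos[of a "Suc n"] pos assms by (auto simp: length_expand)
  have "k \<le> r" using sum_list_mono[of a "\<lambda>_. 1" id] pos assms(2,4) by (simp add: sum_list_triv)
  have m: "1 \<le> r" using \<open>k \<le> r\<close> assms(1) by simp
  let ?t = "\<lambda>q. (- 1) ^ q * real (Suc r choose q)"
  have "?R n =
      (\<Sum>q\<le>n. ?t q * (\<Prod>j<k. (real (n - q) + real (j + 1)) ^ (a ! j)))"
    by (simp add: fps_mult_nth one_minus_fps_X_power_nth atLeast0AtMost del: power_Suc)
  \<comment> \<open>The range \<open>n + Suc r\<close> contains both index sets. For
    \<open>q > n\<close> the factor \<open>j = 0\<close> is truncated to 0 and its exponent is
    positive; for \<open>q > Suc r\<close> the binomial coefficient is 0.\<close>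
  also have "\<dots> = (\<Sum>q\<le>n + Suc r. ?t q * (\<Prod>j<k. real (Suc n + j - q) ^ (a ! j)))"
  proof (rule sum.mono_neutral_cong_left)
    show "\<forall>q\<in>{..n + Suc r} - {..n}. ?t q * (\<Prod>j<k. real (Suc n + j - q) ^ (a ! j)) = 0"
    proof
      fix q assume "q \<in> {..n + Suc r} - {..n}"
      then have "real (Suc n + 0 - q) ^ (a ! 0) = 0" using assms(1,3) by (auto simp: power_0_left)
      then have "(\<Prod>j<k. real (Suc n + j - q) ^ (a ! j)) = 0"
        using assms(1) by (intro prod_zero bexI[of _ 0]) auto
      then show "?t q * (\<Prod>j<k. real (Suc n + j - q) ^ (a ! j)) = 0" by simp
    qed
    show "?t q * (\<Prod>j<k. (real (n - q) + real (j + 1)) ^ (a ! j)) =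
      ?t q * (\<Prod>j<k. real (Suc n + j - q) ^ (a ! j))" if "q \<in> {..n}" for q
      using that by (intro arg_cong2[of _ _ _ _ "(*)"] prod.cong arg_cong2[of _ _ _ _ power]) (auto simp: of_nat_diff)
  qed auto
  also have "\<dots> = (\<Sum>q\<le>Suc r. ?t q * (\<Prod>j<k. real (Suc n + j - q) ^ (a ! j)))"
    by (rule sum.mono_neutral_right) auto
  also have "\<dots> = alt_sum r ?M"
    unfolding alt_sum_def prod_mset_expand assms(2) ..
  finally have rhs: "?R n =
      alt_sum r ?M" .
  have lhs: "fps_nth (fps_of_poly (mixed_eulerian_poly a)) n =
      (if n \<le> r - k then mixed_eulerian (replicate n 0 @ a @ replicate (r - k - n) 0) else 0)"
    using assms(2,4) by (simp add: mixed_eulerian_poly_def Let_def coeff_sum if_distrib sum.delta cong: if_cong)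
  show "fps_nth (fps_of_poly (mixed_eulerian_poly a)) n =
    ?R n"
  proof (cases "n \<le> r - k")
    case True
    let ?b = "replicate n 0 @ a @ replicate (r - k - n) 0"
    have len: "length ?b = r" "sum_list ?b = r"
      using True \<open>k \<le> r\<close> assms(2,4) by (simp_all add: sum_list_replicate)
    obtain F where F: "hpoly (Suc r) r F" "is_volume r F"
        "\<And>c. 0 \<le> c \<Longrightarrow> F (\<lambda>i. if i = 0 then c else 0) = c ^ r / fact r"
      unfolding is_volume_def using volume_shadow[of r] by blast
    have "mixed_eulerian ?b = mixed_coeff_multiset F (mset (expand 1 ?b))"
      using F len by (intro mixed_eulerian_eq_mixed_coeff) auto
    also have "mset (expand 1 ?b) = ?M" by (simp add: expand_append expand_zeros)
    also have "mixed_coeff_multiset F ?M = alt_sum r ?M"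
    proof (rule mixed_coeff_multiset_eq_alt_sum[OF F(2) hpoly_imp_dpoly[OF F(1)] F(3) m])
      show "contiguous r (Suc n) (n + k) ?M"
        using set size assms(1) by (simp add: contiguous_def)
    qed (use True \<open>k \<le> r\<close> in auto)
    finally show ?thesis using True unfolding lhs rhs by simp
  next
    case False
    \<comment> \<open>Beyond degree \<open>r - k\<close> the largest level \<open>n + k\<close> is
      at least \<open>r + 1\<close>, so the alternating sum vanishes and the series
      terminates.\<close>
    then show ?thesis unfolding lhs rhs
      using alt_sum_eq_0_right[OF set, of r] size by simp
  qed
qed

end
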